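(* Let $p\in(0,1]$ and $\psi\in L^p(\mathbb{R}^d)$, and suppose that $$\sigma:=\|\lambda P\psi(b\,\cdot)-1\|_{L^p(\mathcal{C})}^p<1$$ for some $\lambda\in\mathbb{C}$. Then $S:\ell^p(\mathbb{Z}_+\times\mathbb{Z}^d)\to L^p(\mathbb{R}^d)$ is open, and surjective. Indeed, if $f\in L^p(\mathbb{R}^d)$ and $\sigma'\in(\sigma,1)$ then a sequence $c\in\ell^p(\mathbb{Z}_+\times\mathbb{Z}^d)$ exists such that $Sc=f$ and $$\|c\|_{\ell^p(\mathbb{Z}_+\times\mathbb{Z}^d)}\le(1-\sigma')^{-1/p}\,|\lambda|\,|\det b|^{1-1/p}\,\|f\|_p.$$
   Context: Fix a dimension $d\in\mathbb{N}$. Functions and sequences are complex valued. $\mathbb{Z}_+=\{j\in\mathbb{Z}:j>0\}$, $\mathcal{C}=[0,1)^d$. Fix invertible real $d\times d$ matrices $a_j$ ($j\in\mathbb{Z}_+$) with $\|a_j^{-1}\|\to0$ as $j\to\infty$ (operator norm), and an invertible real $d\times d$ matrix $b$. For $p\in(0,1]$, $\|f\|_p=(\int_{\mathbb{R}^d}|f|^p\,dx)^{1/p}$ (and $\|\cdot\|_{L^p(\mathcal{C})}$ is the same with integration over $\mathcal{C}$); $L^p(\mathbb{R}^d)$ has metric $\|f-g\|_p^p$. $\ell^p(\mathbb{Z}_+\times\mathbb{Z}^d)$ is the space of sequences $c=\{c_{j,k}\}_{j>0,k\in\mathbb{Z}^d}$ with $\|c\|_{\ell^p(\mathbb{Z}_+\times\mathbb{Z}^d)}=(\sum_{j>0}\sum_{k}|c_{j,k}|^p)^{1/p}<\infty$,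 with metric $\|c-\tilde c\|_{\ell^p(\mathbb{Z}_+\times\mathbb{Z}^d)}^p$. $\psi_{j,k}(x)=|\det a_j|^{1/p}\psi(a_jx-bk)$, and the synthesis operator is $Sc=\sum_{j>0}\sum_{k\in\mathbb{Z}^d}c_{j,k}\psi_{j,k}$ (the series converges absolutely a.e. to a function in $L^p$ for $c\in\ell^p(\mathbb{Z}_+\times\mathbb{Z}^d)$). Periodization: $P\psi(x)=|\det b|\sum_{k\in\mathbb{Z}^d}\psi(x-bk)$, which for $\psi\in L^p$ converges absolutely a.e.; $P\psi(b\,\cdot)$ denotes $x\mapsto(P\psi)(bx)$, which belongs to $L^p(\mathcal{C})$. *)

theory Defs
  imports "HOL-Analysis.Analysis"
begin

section \<open>The spaces \<open>L\<^sup>p\<close> and \<open>\<ell>\<^sup>p\<close> for \<open>0 < p \<le> 1\<close>\<close>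

definition Lp_fun :: "'a measure \<Rightarrow> real \<Rightarrow> ('a \<Rightarrow> complex) set" where
  "Lp_fun M p = {f \<in> borel_measurable M. integrable M (\<lambda>x. norm (f x) powr p)}"

definition Lp_norm :: "'a measure \<Rightarrow> real \<Rightarrow> ('a \<Rightarrow> complex) \<Rightarrow> real" where
  "Lp_norm M p f = (LINT x|M. norm (f x) powr p) powr (1/p)"

definition Lp_rel :: "'a measure \<Rightarrow> real \<Rightarrow> (('a \<Rightarrow> complex) \<times> ('a \<Rightarrow> complex)) set" where
  "Lp_rel M p = {(f, g). f \<in> Lp_fun M p \<and> g \<in> Lp_fun M p \<and> (AE x in M. f x = g x)}"

text \<open>The class of \<open>f\<close> modulo equality almost everywhere; it is empty if \<open>f\<close> is not in \<open>L\<^sup>p\<close>,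
  so that it is an element of the quotient below exactly for \<open>f\<close> in \<open>L\<^sup>p\<close>.\<close>

definition Lp_class :: "'a measure \<Rightarrow> real \<Rightarrow> ('a \<Rightarrow> complex) \<Rightarrow> ('a \<Rightarrow> complex) set" where
  "Lp_class M p f = Lp_rel M p `` {f}"

definition Lp :: "'a measure \<Rightarrow> real \<Rightarrow> ('a \<Rightarrow> complex) set set" where
  "Lp M p = Lp_fun M p // Lp_rel M p"

text \<open>The metric \<open>\<parallel>f - g\<parallel>\<^sub>p\<^sup>p\<close> on classes; the choice of representatives is immaterial, see
  \<open>Lp_dist_class\<close>.\<close>

definition Lp_dist ::
    "'a measure \<Rightarrow> real \<Rightarrow> ('a \<Rightarrow> complex) set \<Rightarrow> ('a \<Rightarrow> complex) set \<Rightarrow> real" where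
  "Lp_dist M p F G =
     Lp_norm M p (\<lambda>x. (SOME f. f \<in> F) x - (SOME g. g \<in> G) x) powr p"

text \<open>A sequence indexed by a set \<open>I\<close> is a function that vanishes outside \<open>I\<close>.\<close>

definition ell :: "'i set \<Rightarrow> real \<Rightarrow> ('i \<Rightarrow> complex) set" where
  "ell I p = {c. (\<forall>i. i \<notin> I \<longrightarrow> c i = 0) \<and> (\<lambda>i. norm (c i) powr p) summable_on I}"

definition ell_norm :: "'i set \<Rightarrow> real \<Rightarrow> ('i \<Rightarrow> complex) \<Rightarrow> real" where
  "ell_norm I p c = (\<Sum>\<^sub>\<infinity>i\<in>I. norm (c i) powr p) powr (1/p)"

definition ell_dist :: "'i set \<Rightarrow> real \<Rightarrow> ('i \<Rightarrow> complex) \<Rightarrow> ('i \<Rightarrow> complex) \<Rightarrow> real" where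
  "ell_dist I p c c' = ell_norm I p (\<lambda>i. c i - c' i) powr p"


section \<open>Synthesis and periodization\<close>

definition unit_cube :: "(real ^ 'n) set" where
  "unit_cube = {x. \<forall>i. 0 \<le> x $ i \<and> x $ i < 1}"

definition int_vec :: "int ^ 'n \<Rightarrow> real ^ 'n" where
  "int_vec k = (\<chi> i. of_int (k $ i))"

definition scales :: "(nat \<times> (int ^ 'n)) set" where
  "scales = {0<..} \<times> UNIV"

definition wavelet :: "(nat \<Rightarrow> real ^ 'n ^ 'n) \<Rightarrow> real ^ 'n ^ 'n \<Rightarrow> real \<Rightarrow> (real ^ 'n \<Rightarrow> complex) \<Rightarrow>
    nat \<times> (int ^ 'n) \<Rightarrow> real ^ 'n \<Rightarrow> complex" where
  "wavelet a b p \<psi> = (\<lambda>(j, k) x.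
     of_real (\<bar>det (a j)\<bar> powr (1/p)) * \<psi> (a j *v x - b *v int_vec k))"

text \<open>For complex terms, summability in the sense of \<open>\<Sum>\<^sub>\<infinity>\<close> is absolute summability. The two
  series below are given the value \<open>0\<close> at those points where they do not converge absolutely;
  for \<open>c\<close> in \<open>\<ell>\<^sup>p\<close> and \<open>\<psi>\<close> in \<open>L\<^sup>p\<close> these points form a null set.\<close>

definition synthesis :: "(nat \<Rightarrow> real ^ 'n ^ 'n) \<Rightarrow> real ^ 'n ^ 'n \<Rightarrow> real \<Rightarrow> (real ^ 'n \<Rightarrow> complex) \<Rightarrow>
    (nat \<times> (int ^ 'n) \<Rightarrow> complex) \<Rightarrow> (real ^ 'n \<Rightarrow> complex) set" where
  "synthesis a b p \<psi> c =
     Lp_class lebesgue p (\<lambda>x. \<Sum>\<^sub>\<infinity>i\<in>scales. c i * wavelet a b p \<psi> i x)"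

definition periodization :: "real ^ 'n ^ 'n \<Rightarrow> (real ^ 'n \<Rightarrow> complex) \<Rightarrow> real ^ 'n \<Rightarrow> complex" where
  "periodization b \<psi> x = of_real \<bar>det b\<bar> * (\<Sum>\<^sub>\<infinity>k. \<psi> (x - b *v int_vec k))"


section \<open>The distances are metrics\<close>

lemma powr_subadd:
  fixes x y p :: real
  assumes "0 \<le> x" "0 \<le> y" "0 < p" "p \<le> 1"
  shows "(x + y) powr p \<le> x powr p + y powr p"
proof (cases "x + y = 0")
  case True
  then show ?thesis using assms by simp
next
  case False
  define s where "s = x + y"
  have s: "s > 0" using False assms by (simp add: s_def)
  have le: "u / s \<le> (u / s) powr p" if "0 \<le> u" "u \<le> s" for u
    using that s assms powr_mono'[of p 1 "u / s"] by (cases "u = 0") auto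
  have "1 = x / s + y / s" using s by (simp add: s_def flip: add_divide_distrib)
  also have "\<dots> \<le> (x / s) powr p + (y / s) powr p"
    using le[of x] le[of y] assms by (simp add: s_def)
  also have "\<dots> = (x powr p + y powr p) / s powr p"
    using s assms by (simp add: powr_divide add_divide_distrib)
  finally show ?thesis using s by (simp add: s_def pos_le_divide_eq)
qed

lemma norm_powr_triangle:
  fixes u v w :: complex
  assumes "0 < p" "p \<le> 1"
  shows "norm (u - w) powr p \<le> norm (u - v) powr p + norm (v - w) powr p"
proof -
  have "norm (u - w) powr p \<le> (norm (u - v) + norm (v - w)) powr p"
    using assms norm_triangle_ineq[of "u - v" "v - w"] by (intro powr_mono2) auto
  also have "\<dots> \<le> norm (u - v) powr p + norm (v - w) powr p"
    using assms by (intro powr_subadd) auto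
  finally show ?thesis .
qed

lemma norm_powr_diff_le:
  fixes u v :: complex
  assumes "0 < p" "p \<le> 1"
  shows "norm (u - v) powr p \<le> norm u powr p + norm v powr p"
  using norm_powr_triangle[OF assms, of u v 0] by simp

lemma ell_dist_eq:
  assumes "0 < p"
  shows "ell_dist I p c c' = (\<Sum>\<^sub>\<infinity>i\<in>I. norm (c i - c' i) powr p)"
  using assms by (simp add: ell_dist_def ell_norm_def powr_powr infsum_nonneg)

lemma ell_diff_summable:
  assumes "0 < p" "p \<le> 1" "c \<in> ell I p" "c' \<in> ell I p"
  shows "(\<lambda>i. norm (c i - c' i) powr p) summable_on I"
proof (rule summable_on_comparison_test)
  show "(\<lambda>i. norm (c i) powr p + norm (c' i) powr p) summable_on I"
    using assms by (intro summable_on_add) (auto simp: ell_def)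
qed (use assms norm_powr_diff_le in auto)

lemma Metric_space_ell:
  assumes p: "0 < p" "p \<le> 1"
  shows "Metric_space (ell I p) (ell_dist I p)"
proof
  fix c c' c'' :: "'a \<Rightarrow> complex"
  show "0 \<le> ell_dist I p c c'" by (simp add: ell_dist_def)
  show "ell_dist I p c c' = ell_dist I p c' c"
    by (simp add: ell_dist_def ell_norm_def norm_minus_commute)
  assume c: "c \<in> ell I p" and c': "c' \<in> ell I p"
  note sm = ell_diff_summable[OF p]
  show "ell_dist I p c c' = 0 \<longleftrightarrow> c = c'"
  proof
    assume "ell_dist I p c c' = 0"
    then have "norm (c i - c' i) powr p = 0" if "i \<in> I" for i
      using nonneg_infsum_le_0D[OF _ sm[OF c c'] _ that] p by (simp add: ell_dist_eq)
    then have "c i = c' i" for i using c c' by (cases "i \<in> I") (auto simp: ell_def)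
    then show "c = c'" by blast
  qed (use p in \<open>simp add: ell_dist_eq\<close>)
  assume c'': "c'' \<in> ell I p"
  have "ell_dist I p c c'' \<le>
      (\<Sum>\<^sub>\<infinity>i\<in>I. norm (c i - c' i) powr p + norm (c' i - c'' i) powr p)"
    unfolding ell_dist_eq[OF p(1)]
    by (intro infsum_mono sm summable_on_add c c' c'' norm_powr_triangle p)
  also have "\<dots> = ell_dist I p c c' + ell_dist I p c' c''"
    unfolding ell_dist_eq[OF p(1)] by (intro infsum_add sm c c' c'')
  finally show "ell_dist I p c c'' \<le> ell_dist I p c c' + ell_dist I p c' c''" .
qed

lemma equiv_Lp_rel: "equiv (Lp_fun M p) (Lp_rel M p)"
proof (rule equivI)
  show "sym (Lp_rel M p)"
    by (rule symI) (auto simp: Lp_rel_def eq_commute)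
  show "trans (Lp_rel M p)"
  proof (rule transI)
    fix f g h assume "(f, g) \<in> Lp_rel M p" "(g, h) \<in> Lp_rel M p"
    moreover from this have "AE x in M. f x = g x" "AE x in M. g x = h x"
      by (auto simp: Lp_rel_def)
    then have "AE x in M. f x = h x" by eventually_elim simp
    ultimately show "(f, h) \<in> Lp_rel M p" by (auto simp: Lp_rel_def)
  qed
qed (auto simp: Lp_rel_def refl_on_def)

lemma Lp_norm_powr:
  assumes "0 < p"
  shows "Lp_norm M p f powr p = (LINT x|M. norm (f x) powr p)"
  using assms by (simp add: Lp_norm_def powr_powr)

lemma Lp_diff_integrable:
  assumes "0 < p" "p \<le> 1" "f \<in> Lp_fun M p" "g \<in> Lp_fun M p"
  shows "integrable M (\<lambda>x. norm (f x - g x) powr p)"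
proof (rule Bochner_Integration.integrable_bound)
  show "integrable M (\<lambda>x. norm (f x) powr p + norm (g x) powr p)"
    using assms by (auto simp: Lp_fun_def)
  have [measurable]: "f \<in> borel_measurable M" "g \<in> borel_measurable M"
    using assms by (auto simp: Lp_fun_def)
  show "(\<lambda>x. norm (f x - g x) powr p) \<in> borel_measurable M" by measurable
qed (use norm_powr_diff_le[OF assms(1,2)] in auto)

lemma Lp_class_mem: "f \<in> Lp_fun M p \<Longrightarrow> Lp_class M p f \<in> Lp M p"
  by (auto simp: Lp_class_def Lp_def intro: quotientI)

lemma Lp_cases:
  assumes "F \<in> Lp M p"
  obtains f where "f \<in> Lp_fun M p" "F = Lp_class M p f"
  using assms by (auto simp: Lp_class_def Lp_def elim: quotientE)

lemma Lp_class_eq_iff: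
  assumes "f \<in> Lp_fun M p" "g \<in> Lp_fun M p"
  shows "Lp_class M p f = Lp_class M p g \<longleftrightarrow> (AE x in M. f x = g x)"
  using eq_equiv_class_iff[OF equiv_Lp_rel assms] assms by (auto simp: Lp_class_def Lp_rel_def)

lemma Lp_dist_class:
  assumes "0 < p" "f \<in> Lp_fun M p" "g \<in> Lp_fun M p"
  shows "Lp_dist M p (Lp_class M p f) (Lp_class M p g) = Lp_norm M p (\<lambda>x. f x - g x) powr p"
proof -
  define f' where "f' = (SOME h. h \<in> Lp_class M p f)"
  define g' where "g' = (SOME h. h \<in> Lp_class M p g)"
  have "f \<in> Lp_class M p f" "g \<in> Lp_class M p g"
    using assms by (auto simp: Lp_class_def Lp_rel_def)
  then have "f' \<in> Lp_class M p f" "g' \<in> Lp_class M p g"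
    unfolding f'_def g'_def some_in_eq by auto
  then have f': "f' \<in> Lp_fun M p" "AE x in M. f x = f' x"
    and g': "g' \<in> Lp_fun M p" "AE x in M. g x = g' x"
    by (auto simp: Lp_class_def Lp_rel_def)
  have [measurable]: "f \<in> borel_measurable M" "g \<in> borel_measurable M"
    "f' \<in> borel_measurable M" "g' \<in> borel_measurable M"
    using assms f' g' by (auto simp: Lp_fun_def)
  have "(LINT x|M. norm (f' x - g' x) powr p) = (LINT x|M. norm (f x - g x) powr p)"
    by (rule integral_cong_AE) (use f'(2) g'(2) in auto)
  then show ?thesis
    by (simp add: Lp_dist_def Lp_norm_def flip: f'_def g'_def)
qed

lemma Metric_space_Lp:
  assumes p: "0 < p" "p \<le> 1"
  shows "Metric_space (Lp M p) (Lp_dist M p)"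
proof
  fix F G H :: "('a \<Rightarrow> complex) set"
  show "0 \<le> Lp_dist M p F G" by (simp add: Lp_dist_def)
  show "Lp_dist M p F G = Lp_dist M p G F"
    by (simp add: Lp_dist_def Lp_norm_def norm_minus_commute)
  assume "F \<in> Lp M p" "G \<in> Lp M p"
  then obtain f g where f: "f \<in> Lp_fun M p" "F = Lp_class M p f"
    and g: "g \<in> Lp_fun M p" "G = Lp_class M p g"
    by (metis Lp_cases)
  note di = Lp_diff_integrable[OF p] and ds = Lp_dist_class[OF p(1)]
  have "Lp_dist M p F G = 0 \<longleftrightarrow> (AE x in M. norm (f x - g x) powr p = 0)"
    unfolding f(2) g(2) ds[OF f(1) g(1)] Lp_norm_powr[OF p(1)]
    by (intro integral_nonneg_eq_0_iff_AE di f g) auto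
  also have "\<dots> \<longleftrightarrow> F = G"
    using f g by (simp add: Lp_class_eq_iff)
  finally show "Lp_dist M p F G = 0 \<longleftrightarrow> F = G" .
  assume "H \<in> Lp M p"
  then obtain h where h: "h \<in> Lp_fun M p" "H = Lp_class M p h" by (metis Lp_cases)
  have "(LINT x|M. norm (f x - h x) powr p) \<le>
      (LINT x|M. norm (f x - g x) powr p + norm (g x - h x) powr p)"
    by (intro integral_mono di f g h Bochner_Integration.integrable_add norm_powr_triangle p)
  also have "\<dots> = (LINT x|M. norm (f x - g x) powr p) + (LINT x|M. norm (g x - h x) powr p)"
    by (intro Bochner_Integration.integral_add di f g h)
  finally show "Lp_dist M p F H \<le> Lp_dist M p F G + Lp_dist M p G H"
    using f g h by (simp add: ds Lp_norm_powr[OF p(1)])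
qed

end

theory Submission
  imports Defs
begin

text \<open>
  Write \<open>T = a\<^sub>j\<^sup>-\<^sup>1 b\<close> for a large scale \<open>j\<close>. Sampling \<open>f\<close> on a translate \<open>T(\<int>\<^sup>d + t)\<close> of the
  lattice gives coefficients at the single scale \<open>j\<close> whose synthesis is close to
  \<open>f(x) \<cdot> lam P\<psi>(a\<^sub>j x)\<close>. Averaging over the offset \<open>t\<close> in the unit cube makes the two main
  quantities exact, without any continuity of \<open>f\<close>: the mean of \<open>\<parallel>c\<parallel>\<^sup>p\<close> is
  \<open>\<bar>lam\<bar>\<^sup>p \<bar>det b\<bar>\<^sup>p\<^sup>-\<^sup>1 \<parallel>f\<parallel>\<^sup>p\<close>, and the mean of the main part of \<open>\<parallel>f - Sc\<parallel>\<^sup>p\<close> is \<open>\<sigma> \<parallel>f\<parallel>\<^sup>p\<close>. What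
  remains is controlled by the continuity of translations in \<open>L\<^sup>p\<close>. One offset has to serve both
  bounds, so the average is taken of a weighted sum of the two, chosen such that the inequality
  obtained telescopes when the step is repeated with \<open>f - Sc\<close> in place of \<open>f\<close>. The sum of the
  resulting coefficient sequences is the solution; openness follows by linearity.
\<close>

section \<open>Lebesgue measure under linear maps, and the tiling by unit cubes\<close>

text \<open>For p < 1 a function in the p-space need not be locally integrable, so cell averages of
  f cannot serve as coefficients; point samples can, at the price of depending on the offset t. In
  coordinates x = T(y + m) with y in the unit cube, f(x) is compared with the sample at T(t + m),
  while the synthesis at x uses the samples at T(t + m - l), weighted by the part of \<psi> in cell
  l. The error therefore splits into oscillation within a cell, the sample times the defect
  \<open>h lam y\<close>, and differences between samples l cells apart. The weights come from the
  means. Let n be the p-th power of the norm of f, and Y the normalized p-th power of the norm of c.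
  Then Y has mean n, so (1 - \<sigma>') Y plus the error has mean (1 - \<sigma>' + \<sigma>) n up to
  small terms. The gap (\<sigma>' - \<sigma>) n absorbs these terms and still leaves half of itself
  as gain. When the steps are summed, the Y terms give exactly the factor 1/(1 - \<sigma>'), and the
  gains make the norms of the residuals summable. The small terms vanish only for a fixed function
  as the scale grows, with no uniform rate, so each residual needs a scale of its own.\<close>

text \<open>The library proves the change of variables for index types of class \<open>wellorder\<close> only.\<close>

lemma swap_coordinates:
  fixes m n :: "'n::finite"
  defines "\<tau> \<equiv> Transposition.transpose m n"
  defines "h \<equiv> \<lambda>x :: real ^ 'n. \<chi> i. x $ \<tau> i"
  shows "linear h" "\<bar>det (matrix h)\<bar> = 1" "measure lebesgue (h ` cbox u v) = measure lebesgue (cbox u v)"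
proof -
  have \<tau>: "\<tau> permutes UNIV" and \<tau>\<tau>: "\<tau> (\<tau> i) = i" for i
    by (simp_all add: \<tau>_def permutes_swap_id)
  show "linear h" by (rule linearI) (auto simp: h_def vec_eq_iff)
  have "matrix h = (\<chi> i. mat 1 $ \<tau> i)"
    by (auto simp: h_def matrix_def mat_def axis_def vec_eq_iff)
  then show "\<bar>det (matrix h)\<bar> = 1"
    by (simp add: det_permute_rows[OF \<tau>] sign_def)
  have "h ` cbox u v = cbox (h u) (h v)"
  proof (intro set_eqI iffI)
    fix x assume "x \<in> h ` cbox u v"
    then show "x \<in> cbox (h u) (h v)" by (clarsimp simp: h_def mem_box_cart)
  next
    fix x assume "x \<in> cbox (h u) (h v)"
    then have "h x \<in> cbox u v" by (simp add: h_def mem_box_cart) (metis \<tau>\<tau>)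
    then show "x \<in> h ` cbox u v" by (rule rev_image_eqI) (simp add: h_def \<tau>\<tau> vec_eq_iff)
  qed
  moreover have "cbox (h u) (h v) = {} \<longleftrightarrow> cbox u v = {}"
    unfolding interval_eq_empty_cart h_def by simp (metis \<tau>\<tau>)
  moreover have "(\<Prod>i\<in>UNIV. v $ \<tau> i - u $ \<tau> i) = (\<Prod>i\<in>UNIV. v $ i - u $ i)"
    using prod.permute[OF \<tau>, of "\<lambda>i. v $ i - u $ i"] by (simp add: o_def)
  ultimately show "measure lebesgue (h ` cbox u v) = measure lebesgue (cbox u v)"
    by (simp add: content_cbox_if_cart h_def)
qed

lemma shear_coordinates:
  fixes m n :: "'n::finite"
  assumes mn: "m \<noteq> n"
  defines "h \<equiv> \<lambda>x :: real ^ 'n. \<chi> i. if i = m then x $ m + x $ n else x $ i"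
  shows "linear h" "\<bar>det (matrix h)\<bar> = 1" "measure lebesgue (h ` cbox u v) = measure lebesgue (cbox u v)"
proof -
  show lin: "linear h" by (rule linearI) (simp_all add: h_def vec_eq_iff distrib_left)
  have "matrix h = (\<chi> k. if k = m then row m (mat 1) + 1 *s row n (mat 1) else row k (mat 1))"
    by (auto simp: h_def matrix_def mat_def axis_def row_def vec_eq_iff)
  then show "\<bar>det (matrix h)\<bar> = 1"
    by (simp only: det_row_operation[OF mn] det_I abs_one)
  \<comment> \<open>\<open>measure_shear_interval\<close> asks for a nonempty box whose lower corner
    has nonnegative coordinate \<open>n\<close>. Translating by \<open>c\<close> makes that
    coordinate 0, and translations do not change the measure.\<close>
  define c where "c = axis n (u $ n)"
  have im: "h ` cbox u v = (+) (h c) ` (h ` cbox (u - c) (v - c))"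
  proof -
    have "cbox u v = (+) c ` cbox (u - c) (v - c)"
      by (simp add: cbox_translation[symmetric])
    then show ?thesis by (simp add: image_image linear_add[OF lin])
  qed
  have "measure lebesgue (h ` cbox (u - c) (v - c)) = measure lebesgue (cbox (u - c) (v - c))"
  proof (cases "cbox (u - c) (v - c) = {}")
    case False
    then show ?thesis unfolding h_def by (rule measure_shear_interval[OF mn]) (simp add: c_def)
  qed simp
  also have "\<dots> = measure lebesgue (cbox u v)"
    using measure_translation[of "- c" "cbox u v"] by (simp only: cbox_translation[symmetric]) simp
  finally show "measure lebesgue (h ` cbox u v) = measure lebesgue (cbox u v)"
    unfolding im measure_translation .
qed

text \<open>The determinant formula is stable under composition, so it suffices to check the
  elementary maps. A map with a vanishing coordinate has negligible image and determinant 0;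
  stretches are diagonal; swaps and shears have determinant of modulus 1, and for them a comparison
  on boxes is enough.\<close>

lemma measure_linear_image_cart:
  fixes f :: "real ^ 'n \<Rightarrow> real ^ 'n"
  assumes "linear f" "S \<in> lmeasurable"
  shows "f ` S \<in> lmeasurable \<and> measure lebesgue (f ` S) = \<bar>det (matrix f)\<bar> * measure lebesgue S"
proof -
  define P where "P f \<longleftrightarrow> (\<forall>S \<in> lmeasurable. f ` S \<in> lmeasurable \<and>
    measure lebesgue (f ` S) = \<bar>det (matrix f)\<bar> * measure lebesgue S)" for f :: "real ^ 'n \<Rightarrow> real ^ 'n"
  have PI: "P h" if "linear h" "\<bar>det (matrix h)\<bar> = 1"
    "\<And>u v. measure lebesgue (h ` cbox u v) = measure lebesgue (cbox u v)" for h
    unfolding P_def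
  proof
    fix S :: "(real ^ 'n) set" assume "S \<in> lmeasurable"
    then have "h ` S \<in> lmeasurable \<and> 1 * measure lebesgue S = measure lebesgue (h ` S)"
      by (rule measure_linear_sufficient[OF that(1)]) (simp add: that(3))
    then show "h ` S \<in> lmeasurable \<and> measure lebesgue (h ` S) = \<bar>det (matrix h)\<bar> * measure lebesgue S"
      by (simp add: that(2))
  qed
  have "P f"
  proof (rule induct_linear_elementary[OF assms(1)])
    fix f g :: "real ^ 'n \<Rightarrow> real ^ 'n"
    assume lin: "linear f" "linear g" and "P f" "P g"
    then show "P (f \<circ> g)"
      by (simp add: P_def image_comp[symmetric] matrix_compose[OF lin(2,1)] det_mul abs_mult del: o_apply)
  next
    fix f :: "real ^ 'n \<Rightarrow> real ^ 'n" and i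
    assume lin: "linear f" and 0: "\<And>x. f x $ i = 0"
    have ninj: "\<not> inj f"
      by (metis lin 0 linear_injective_imp_surjective one_neq_zero surjE vec_component)
    then show "P f"
      using det_nz_iff_inj[OF lin] negligible_linear_singular_image[OF lin]
      by (auto simp: P_def negligible_imp_measurable negligible_imp_measure0)
  next
    fix c :: "'n \<Rightarrow> real"
    have "matrix (\<lambda>x. \<chi> i. c i * x $ i) = (\<chi> i j. if i = j then c i else 0)"
      by (auto simp: matrix_def axis_def vec_eq_iff)
    then have "det (matrix (\<lambda>x. \<chi> i. c i * x $ i)) = prod c UNIV"
      by (simp add: det_diagonal)
    then show "P (\<lambda>x. \<chi> i. c i * x $ i)"
      by (simp add: P_def measurable_stretch measure_stretch)
  next
    fix m n :: 'n
    assume "m \<noteq> n"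
    show "P (\<lambda>x. \<chi> i. x $ Transposition.transpose m n i)"
      by (intro PI swap_coordinates)
  next
    fix m n :: 'n
    assume "m \<noteq> n"
    then show "P (\<lambda>x. \<chi> i. if i = m then x $ m + x $ n else x $ i)"
      by (intro PI shear_coordinates)
  qed
  then show ?thesis using assms(2) by (auto simp: P_def)
qed

text \<open>Preimages under \<open>A\<close> are images under its inverse \<open>B\<close>, so the
  image formula for sets of finite measure carries over: exhaustion by balls gives measurability,
  and the pushforward of Lebesgue measure under \<open>A\<close> is Lebesgue measure with constant
  density \<bar>det B\<bar>. Integrating against this identity of measures is the change of
  variables.\<close>

lemma
  fixes A :: "real ^ 'n ^ 'n"
  assumes A: "invertible A"
  shows measurable_matrix_lebesgue: "(\<lambda>x. A *v x) \<in> lebesgue \<rightarrow>\<^sub>M lebesgue"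
    and nn_integral_matrix_lebesgue: "F \<in> borel_measurable lebesgue \<Longrightarrow>
      (\<integral>\<^sup>+x. F x \<partial>lebesgue) = \<bar>det A\<bar> * (\<integral>\<^sup>+x. F (A *v x) \<partial>lebesgue)"
proof -
  obtain B where BA: "B ** A = mat 1" "A ** B = mat 1"
    using A by (auto simp: invertible_def)
  have BAv: "B *v (A *v x) = x" "A *v (B *v x) = x" for x
    by (simp_all add: matrix_vector_mul_assoc BA)
  have dAB: "\<bar>det A\<bar> * \<bar>det B\<bar> = 1"
    using arg_cong[OF BA(2), of det] by (simp add: det_mul flip: abs_mult)
  have vim: "(*v) A -` S = (*v) B ` S" for S
    using BAv by (auto intro: rev_image_eqI)
  have lm: "(*v) C ` S \<in> lmeasurable" if "S \<in> lmeasurable" for C :: "real ^ 'n ^ 'n" and S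
    using measure_linear_image_cart[OF matrix_vector_mul_linear] that by auto
  show meas: "(\<lambda>x. A *v x) \<in> lebesgue \<rightarrow>\<^sub>M lebesgue"
  proof (rule measurableI)
    fix S :: "(real ^ 'n) set" assume S: "S \<in> sets lebesgue"
    define U where "U k = S \<inter> cball 0 (real k)" for k
    have "(*v) B ` S = (*v) B ` (\<Union>k. U k)"
      by (rule arg_cong[where f="(`) _"]) (auto simp: U_def intro: real_arch_simple)
    also have "\<dots> = (\<Union>k. (*v) B ` U k)" by (rule image_UN)
    also have "\<dots> \<in> sets lebesgue"
    proof (intro sets.countable_UN subsetI, elim imageE)
      fix k X assume X: "X = (*v) B ` U k"
      have "U k \<in> lmeasurable"
        using S unfolding U_def by (intro bounded_set_imp_lmeasurable) auto
      from fmeasurableD[OF lm[OF this, of B]] show "X \<in> sets lebesgue" unfolding X .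
    qed
    finally show "(*v) A -` S \<inter> space lebesgue \<in> sets lebesgue" by (simp add: vim)
  qed simp
  have top: "emeasure lebesgue X = top" if "X \<notin> lmeasurable" "X \<in> sets lebesgue" for X :: "(real ^ 'n) set"
  proof (rule ccontr)
    assume "emeasure lebesgue X \<noteq> top"
    then have "emeasure lebesgue X < \<infinity>" by (simp only: top.not_eq_extremum infinity_ennreal_def)
    then show False using that fmeasurableI by blast
  qed
  \<comment> \<open>Infinite measure is treated separately: if the image under \<open>B\<close> had
    finite measure, then so would \<open>S\<close>, which is recovered from it by applying
    \<open>A\<close>.\<close>
  have em: "emeasure lebesgue ((*v) B ` S) = \<bar>det B\<bar> * emeasure lebesgue S"
    if S: "S \<in> sets lebesgue" for S
  proof (cases "S \<in> lmeasurable")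
    case True
    then show ?thesis
      using measure_linear_image_cart[OF matrix_vector_mul_linear, of S B]
      by (simp add: emeasure_eq_measure2 ennreal_mult)
  next
    case False
    have "(*v) A ` ((*v) B ` S) = S" by (simp add: image_image BAv)
    with False lm[of "(*v) B ` S" A] have "(*v) B ` S \<notin> lmeasurable" by argo
    moreover have "(*v) B ` S \<in> sets lebesgue"
      using measurable_sets[OF meas S] by (simp add: vim)
    ultimately have "emeasure lebesgue ((*v) B ` S) = top" by (intro top)
    moreover have "emeasure lebesgue S = top" using False S by (rule top)
    moreover have "\<bar>det B\<bar> \<noteq> 0" using dAB by auto
    ultimately show ?thesis
      by (simp only: ennreal_mult_top ennreal_eq_0_iff) simp
  qed
  have eq: "distr lebesgue lebesgue ((*v) A) = density lebesgue (\<lambda>_. ennreal \<bar>det B\<bar>)"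
    by (rule measure_eqI) (simp_all add: emeasure_distr[OF meas] vim em emeasure_density nn_integral_cmult_indicator)
  assume F: "F \<in> borel_measurable lebesgue"
  have "(\<integral>\<^sup>+x. F (A *v x) \<partial>lebesgue) = (\<integral>\<^sup>+x. F x \<partial>distr lebesgue lebesgue ((*v) A))"
    using F by (subst nn_integral_distr[OF meas]) simp_all
  also have "\<dots> = \<bar>det B\<bar> * (\<integral>\<^sup>+x. F x \<partial>lebesgue)"
    unfolding eq using F by (simp add: nn_integral_density nn_integral_cmult)
  finally have *: "(\<integral>\<^sup>+x. F (A *v x) \<partial>lebesgue) = \<bar>det B\<bar> * (\<integral>\<^sup>+x. F x \<partial>lebesgue)" .
  have "ennreal \<bar>det A\<bar> * (\<integral>\<^sup>+x. F (A *v x) \<partial>lebesgue) =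
      ennreal (\<bar>det A\<bar> * \<bar>det B\<bar>) * (\<integral>\<^sup>+x. F x \<partial>lebesgue)"
    unfolding * by (simp add: ennreal_mult mult.assoc)
  then show "(\<integral>\<^sup>+x. F x \<partial>lebesgue) = \<bar>det A\<bar> * (\<integral>\<^sup>+x. F (A *v x) \<partial>lebesgue)"
    by (simp only: dAB ennreal_1 mult_1)
qed

lemma
  fixes c :: "'a::euclidean_space"
  shows measurable_add_lebesgue: "(\<lambda>x. x + c) \<in> lebesgue \<rightarrow>\<^sub>M lebesgue"
    and nn_integral_add_lebesgue: "F \<in> borel_measurable lebesgue \<Longrightarrow>
      (\<integral>\<^sup>+x. F (x + c) \<partial>lebesgue) = (\<integral>\<^sup>+x. F x \<partial>lebesgue)"
proof -
  have T: "c + (\<Sum>j\<in>Basis. (1 * (x \<bullet> j)) *\<^sub>R j) = x + c" for x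
    by (simp add: euclidean_representation add.commute)
  show meas: "(\<lambda>x. x + c) \<in> lebesgue \<rightarrow>\<^sub>M lebesgue"
    by (rule lebesgue_affine_measurable[of "\<lambda>_. 1" c, unfolded T, OF one_neq_zero])
  assume F: "F \<in> borel_measurable lebesgue"
  have "density (distr lebesgue lebesgue (\<lambda>x. x + c)) (\<lambda>x. ennreal (\<Prod>j\<in>(Basis::'a set). \<bar>1\<bar>)) =
      distr lebesgue lebesgue (\<lambda>x. x + c)"
    by (simp add: density_1)
  note eq = trans[OF lebesgue_affine_euclidean[of "\<lambda>_. 1" c, unfolded T, OF one_neq_zero] this]
  have "(\<integral>\<^sup>+x. F x \<partial>lebesgue) = (\<integral>\<^sup>+x. F x \<partial>distr lebesgue lebesgue (\<lambda>x. x + c))"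
    by (rule arg_cong[where f="\<lambda>M. nn_integral M F", OF eq])
  also have "\<dots> = (\<integral>\<^sup>+x. F (x + c) \<partial>lebesgue)"
    using F by (subst nn_integral_distr[OF meas]) simp_all
  finally show "(\<integral>\<^sup>+x. F (x + c) \<partial>lebesgue) = (\<integral>\<^sup>+x. F x \<partial>lebesgue)" ..
qed

section \<open>Tiling of space by integer translates of the half-open unit cube\<close>

definition floor_vec :: "real ^ 'n \<Rightarrow> int ^ 'n" where
  "floor_vec x = (\<chi> i. \<lfloor>x $ i\<rfloor>)"

text \<open>In each coordinate this is the characterization of the floor. That the cube is half-open
  makes the cell of a point unique, so the translates form an exact partition.\<close>

lemma diff_int_vec_in_unit_cube: "x - int_vec m \<in> unit_cube \<longleftrightarrow> m = floor_vec x"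
proof -
  have "0 \<le> x $ i - real_of_int (m $ i) \<and> x $ i - real_of_int (m $ i) < 1 \<longleftrightarrow> m $ i = \<lfloor>x $ i\<rfloor>" for i
    by linarith
  then show ?thesis by (simp add: unit_cube_def int_vec_def floor_vec_def vec_eq_iff)
qed

lemma borel_unit_cube: "unit_cube \<in> sets borel"
proof -
  have "unit_cube = (\<Inter>i. {x :: real ^ 'n. 0 \<le> x $ i} \<inter> {x. x $ i < 1})"
    by (auto simp: unit_cube_def)
  also have "\<dots> \<in> sets borel"
    by (intro sets.countable_INT'') (auto intro!: closed_halfspace_component_ge_cart open_halfspace_component_lt_cart borel_closed borel_open sets.Int)
  finally show ?thesis .
qed

lemma sets_unit_cube [measurable]: "unit_cube \<in> sets lebesgue"
  using borel_unit_cube by (intro sets_completionI_sets) simp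

abbreviation cube_integral :: "(real ^ 'n \<Rightarrow> ennreal) \<Rightarrow> ennreal" where
  "cube_integral F \<equiv> \<integral>\<^sup>+x. F x \<partial>lebesgue_on unit_cube"

lemma cube_integral_eq: "cube_integral F = (\<integral>\<^sup>+x. F x * indicator unit_cube x \<partial>lebesgue)"
  by (rule nn_integral_restrict_space) (simp add: sets_unit_cube)

text \<open>The indicators of the translated cubes sum to 1 at every point. Inserting this sum,
  exchanging it with the integral and translating each piece back to the cube gives the
  identity.\<close>

lemma nn_integral_tiling:
  fixes F :: "real ^ 'n \<Rightarrow> ennreal"
  assumes F[measurable]: "F \<in> borel_measurable lebesgue"
  shows "(\<integral>\<^sup>+x. F x \<partial>lebesgue) = (\<integral>\<^sup>+m. cube_integral (\<lambda>x. F (x + int_vec m)) \<partial>count_space UNIV)"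
proof -
  have meas: "(\<lambda>x. F x * indicator unit_cube (x - int_vec m)) \<in> borel_measurable lebesgue" for m
  proof -
    have "(\<lambda>x. F x * indicator unit_cube (x + - int_vec m)) \<in> borel_measurable lebesgue"
      by (intro borel_measurable_times_ennreal F measurable_compose[OF measurable_add_lebesgue]
          borel_measurable_indicator sets_unit_cube)
    then show ?thesis by simp
  qed
  have "(\<integral>\<^sup>+x. F x \<partial>lebesgue) =
      (\<integral>\<^sup>+x. \<integral>\<^sup>+m. F x * indicator unit_cube (x - int_vec m) \<partial>count_space UNIV \<partial>lebesgue)"
  proof (rule nn_integral_cong)
    fix x
    have "(\<integral>\<^sup>+m. F x * indicator unit_cube (x - int_vec m) \<partial>count_space UNIV) =
       (\<integral>\<^sup>+m. F x * indicator {floor_vec x} m \<partial>count_space UNIV)"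
      by (intro nn_integral_cong) (auto simp: indicator_def diff_int_vec_in_unit_cube)
    then show "F x = (\<integral>\<^sup>+m. F x * indicator unit_cube (x - int_vec m) \<partial>count_space UNIV)"
      by (simp add: nn_integral_cmult_indicator)
  qed
  also have "\<dots> = (\<integral>\<^sup>+m. \<integral>\<^sup>+x. F x * indicator unit_cube (x - int_vec m) \<partial>lebesgue \<partial>count_space UNIV)"
    by (intro nn_integral_count_space_nn_integral meas) auto
  also have "\<dots> = (\<integral>\<^sup>+m. \<integral>\<^sup>+x. F (x + int_vec m) * indicator unit_cube x \<partial>lebesgue \<partial>count_space UNIV)"
  proof (rule nn_integral_cong)
    fix m :: "int ^ 'n"
    show "(\<integral>\<^sup>+x. F x * indicator unit_cube (x - int_vec m) \<partial>lebesgue) =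
        (\<integral>\<^sup>+x. F (x + int_vec m) * indicator unit_cube x \<partial>lebesgue)"
      using nn_integral_add_lebesgue[OF meas, of "int_vec m" m] by simp
  qed
  finally show ?thesis by (simp only: cube_integral_eq)
qed

lemma emeasure_unit_cube: "emeasure lebesgue (unit_cube :: (real ^ 'n) set) = 1"
proof -
  have m: "box 0 1 \<in> sets (lebesgue :: (real ^ 'n) measure)" "cbox 0 1 \<in> sets (lebesgue :: (real ^ 'n) measure)"
    by auto
  have box: "box 0 1 \<subseteq> unit_cube" "unit_cube \<subseteq> cbox 0 (1 :: real ^ 'n)"
    by (auto simp: unit_cube_def mem_box_cart less_imp_le)
  have "\<And>b :: real ^ 'n. b \<in> Basis \<Longrightarrow> 1 \<bullet> b = 1"
    by (auto simp: Basis_vec_def inner_axis)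
  then have "emeasure lebesgue (box 0 (1 :: real ^ 'n)) = 1" "emeasure lebesgue (cbox 0 (1 :: real ^ 'n)) = 1"
    by (simp_all add: emeasure_lborel_box_eq emeasure_lborel_cbox_eq)
  then show ?thesis
    using emeasure_mono[OF box(1) sets_unit_cube] emeasure_mono[OF box(2) m(2)] by (metis order_antisym)
qed

section \<open>Sums of \<open>p\<close>-th powers, and small oscillation in \<open>L\<^sup>p\<close>\<close>

text \<open>Taking values in \<open>ennreal\<close> lets lattice sums and integrals be exchanged,
  and inequalities be integrated, without convergence side conditions.\<close>

definition pabs :: "real \<Rightarrow> complex \<Rightarrow> ennreal" where
  "pabs p z = ennreal (norm z powr p)"

lemma pabs_0 [simp]: "pabs p 0 = 0" by (simp add: pabs_def)

lemma pabs_less_top [simp]: "pabs p z < top" by (simp add: pabs_def)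

lemma pabs_minus [simp]: "pabs p (- z) = pabs p z" by (simp add: pabs_def)

lemma pabs_minus_commute: "pabs p (w - z) = pabs p (z - w)"
  by (simp add: pabs_def norm_minus_commute)

lemma pabs_mult: "pabs p (w * z) = pabs p w * pabs p z"
  by (simp add: pabs_def norm_mult powr_mult ennreal_mult)

lemma measurable_pabs [measurable]: "pabs p \<in> borel_measurable borel"
  unfolding pabs_def by measurable

lemma pabs_eq_0_iff: "pabs p z = 0 \<longleftrightarrow> z = 0"
  by (simp add: pabs_def)

lemma powr_sum_le:
  fixes f :: "'a \<Rightarrow> real"
  assumes "0 < p" "p \<le> 1" "finite F" "\<And>i. i \<in> F \<Longrightarrow> 0 \<le> f i"
  shows "(\<Sum>i\<in>F. f i) powr p \<le> (\<Sum>i\<in>F. f i powr p)"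
  using assms(3,4)
proof (induction F)
  case (insert i F)
  then have "(f i + (\<Sum>i\<in>F. f i)) powr p \<le> f i powr p + (\<Sum>i\<in>F. f i) powr p"
    using assms(1,2) by (intro powr_subadd) (auto intro: sum_nonneg)
  with insert show ?case by simp
qed simp

lemma sum_le_nn_integral_count_space:
  assumes "finite F" "F \<subseteq> A"
  shows "(\<Sum>i\<in>F. f i) \<le> (\<integral>\<^sup>+i. f i \<partial>count_space A)"
proof -
  have "(\<Sum>i\<in>F. f i) = (\<integral>\<^sup>+i. f i * indicator F i \<partial>count_space A)"
    using assms by (subst nn_integral_count_space'[of F]) auto
  also have "\<dots> \<le> (\<integral>\<^sup>+i. f i \<partial>count_space A)"
    by (intro nn_integral_mono) (auto simp: indicator_def)
  finally show ?thesis .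
qed

context
  fixes p :: real
  assumes p: "0 < p" "p \<le> 1"
begin

lemma pabs_mono: "norm z \<le> norm w \<Longrightarrow> pabs p z \<le> pabs p w"
  using p by (auto simp: pabs_def intro!: ennreal_leI powr_mono2)

lemma pabs_add_le: "pabs p (w + z) \<le> pabs p w + pabs p z"
  using norm_powr_diff_le[OF p, of w "- z"] by (simp add: pabs_def flip: ennreal_plus)

lemma pabs_diff_le: "pabs p (w - z) \<le> pabs p w + pabs p z"
  using pabs_add_le[of w "- z"] by simp

lemma pabs_diff_triangle: "pabs p (u - w) \<le> pabs p (u - v) + pabs p (v - w)"
  using pabs_add_le[of "u - v" "v - w"] by simp

text \<open>For p \<le> 1, subadditivity of the p-th power bounds every finite sum of norms by
  \<open>S powr (1/p)\<close>, where \<open>S\<close> is the sum of the p-th powers. So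
  p-summability implies absolute summability, and the subadditivity passes to the infinite
  series.\<close>

lemma
  fixes f :: "'i \<Rightarrow> complex"
  assumes fin: "(\<integral>\<^sup>+i. pabs p (f i) \<partial>count_space A) < \<infinity>"
  shows pabs_summable: "(\<lambda>i. norm (f i)) summable_on A" "f summable_on A"
    and pabs_infsum_le_finite: "pabs p (infsum f A) \<le> (\<integral>\<^sup>+i. pabs p (f i) \<partial>count_space A)"
proof -
  obtain S where S: "0 \<le> S" "(\<integral>\<^sup>+i. pabs p (f i) \<partial>count_space A) = ennreal S"
    using fin by (cases "\<integral>\<^sup>+i. pabs p (f i) \<partial>count_space A") auto
  have bound: "(\<Sum>i\<in>F. norm (f i)) \<le> S powr (1/p)" if "finite F" "F \<subseteq> A" for F
  proof -
    have "ennreal (\<Sum>i\<in>F. norm (f i) powr p) \<le> ennreal S"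
      using sum_le_nn_integral_count_space[OF that, of "\<lambda>i. pabs p (f i)"]
      unfolding S(2) by (simp add: pabs_def sum_ennreal)
    then have "(\<Sum>i\<in>F. norm (f i) powr p) \<le> S" using S(1) by simp
    with powr_sum_le[OF p that(1), of "\<lambda>i. norm (f i)"]
    have "(\<Sum>i\<in>F. norm (f i)) powr p \<le> S" by simp
    then have "((\<Sum>i\<in>F. norm (f i)) powr p) powr (1/p) \<le> S powr (1/p)"
      using p by (intro powr_mono2) auto
    then show ?thesis using p by (simp add: powr_powr sum_nonneg)
  qed
  show sm: "(\<lambda>i. norm (f i)) summable_on A"
    using bound by (intro nonneg_bdd_above_summable_on bdd_aboveI2[where M="S powr (1/p)"]) auto
  then show "f summable_on A" by (rule abs_summable_summable)
  have "norm (infsum f A) \<le> (\<Sum>\<^sub>\<infinity>i\<in>A. norm (f i))" by (rule norm_infsum_bound[OF sm])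
  also have "\<dots> \<le> S powr (1/p)" by (rule infsum_le_finite_sums[OF sm bound])
  finally have "norm (infsum f A) powr p \<le> (S powr (1/p)) powr p"
    using p by (intro powr_mono2) auto
  then have "norm (infsum f A) powr p \<le> S" using p S(1) by (simp add: powr_powr)
  then show "pabs p (infsum f A) \<le> (\<integral>\<^sup>+i. pabs p (f i) \<partial>count_space A)"
    unfolding S(2) by (simp add: pabs_def ennreal_leI)
qed

text \<open>If the right-hand side is infinite the claim is trivial, which also covers series that
  do not converge and have the default value 0.\<close>

lemma pabs_infsum_le: "pabs p (infsum f A) \<le> (\<integral>\<^sup>+i. pabs p (f i) \<partial>count_space A)"
  by (cases "(\<integral>\<^sup>+i. pabs p (f i) \<partial>count_space A) < \<infinity>")
    (simp_all add: pabs_infsum_le_finite not_less top_unique)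

end

section \<open>Norms and series expressed through nonnegative integrals\<close>

lemma Lp_fun_iff:
  "f \<in> Lp_fun M p \<longleftrightarrow> f \<in> borel_measurable M \<and> (\<integral>\<^sup>+x. pabs p (f x) \<partial>M) < \<infinity>"
  unfolding Lp_fun_def by (auto simp: integrable_iff_bounded pabs_def)

lemma Lp_norm_powr_eq:
  assumes "0 < p" "f \<in> Lp_fun M p"
  shows "ennreal (Lp_norm M p f powr p) = (\<integral>\<^sup>+x. pabs p (f x) \<partial>M)"
  using assms unfolding Lp_norm_powr[OF assms(1)] pabs_def
  by (subst nn_integral_eq_integral) (auto simp: Lp_fun_def)

lemma summable_on_iff_nn_integral:
  fixes g :: "'i \<Rightarrow> real"
  assumes "\<And>i. 0 \<le> g i"
  shows "g summable_on I \<longleftrightarrow> (\<integral>\<^sup>+i. ennreal (g i) \<partial>count_space I) < \<infinity>"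
    and "g summable_on I \<Longrightarrow> ennreal (infsum g I) = (\<integral>\<^sup>+i. ennreal (g i) \<partial>count_space I)"
proof -
  have *: "g summable_on I \<longleftrightarrow> Infinite_Set_Sum.abs_summable_on g I"
    using abs_summable_equivalent[of g I] assms by simp
  then show "g summable_on I \<longleftrightarrow> (\<integral>\<^sup>+i. ennreal (g i) \<partial>count_space I) < \<infinity>"
    using assms by (simp add: Infinite_Set_Sum.abs_summable_on_def integrable_iff_bounded)
  show "g summable_on I \<Longrightarrow> ennreal (infsum g I) = (\<integral>\<^sup>+i. ennreal (g i) \<partial>count_space I)"
    using * assms by (simp add: nn_integral_conv_infsetsum infsetsum_infsum)
qed

lemma ell_iff:
  "c \<in> ell I p \<longleftrightarrow> (\<forall>i. i \<notin> I \<longrightarrow> c i = 0) \<and> (\<integral>\<^sup>+i. pabs p (c i) \<partial>count_space I) < \<infinity>"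
  by (simp add: ell_def pabs_def summable_on_iff_nn_integral)

lemma ell_norm_powr:
  assumes "0 < p" "c \<in> ell I p"
  shows "ennreal (ell_norm I p c powr p) = (\<integral>\<^sup>+i. pabs p (c i) \<partial>count_space I)"
proof -
  have "ell_norm I p c powr p = (\<Sum>\<^sub>\<infinity>i\<in>I. norm (c i) powr p)"
    using assms(1) by (simp add: ell_norm_def powr_powr infsum_nonneg)
  then show ?thesis
    using assms(2) by (simp add: summable_on_iff_nn_integral pabs_def ell_def)
qed

text \<open>The default values agree: both sides are 0 when the series does not converge absolutely.
  The identity reduces measurability of a series in a parameter to that of a parameter
  integral.\<close>

lemma infsum_eq_integral:
  fixes f :: "'i \<Rightarrow> complex"
  shows "infsum f I = (\<integral>i. f i \<partial>count_space I)"
proof (cases "f summable_on I")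
  case True
  then have "Infinite_Set_Sum.abs_summable_on f I"
    using summable_on_iff_abs_summable_on_complex abs_summable_equivalent by blast
  then show ?thesis by (simp add: infsetsum_infsum[symmetric] infsetsum_def)
next
  case False
  then have "\<not> Infinite_Set_Sum.abs_summable_on f I"
    by (simp add: summable_on_iff_abs_summable_on_complex abs_summable_equivalent)
  with False show ?thesis
    by (simp add: infsum_not_exists Infinite_Set_Sum.abs_summable_on_def not_integrable_integral_eq)
qed

lemma measurable_pair_count_space:
  assumes I: "countable I" and f: "\<And>i. i \<in> I \<Longrightarrow> f i \<in> measurable M N"
  shows "(\<lambda>(x, i). f i x) \<in> measurable (M \<Otimes>\<^sub>M count_space I) N"
proof -
  have "(\<lambda>(i, x). f i x) \<in> measurable (count_space I \<Otimes>\<^sub>M M) N"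
    using f by (intro measurable_pair_measure_countable1 I) auto
  then show ?thesis
    by (subst measurable_pair_swap_iff) (simp add: case_prod_beta')
qed

lemma borel_measurable_infsum:
  fixes f :: "'i \<Rightarrow> 'a \<Rightarrow> complex"
  assumes I: "countable I" and f: "\<And>i. i \<in> I \<Longrightarrow> f i \<in> borel_measurable M"
  shows "(\<lambda>x. \<Sum>\<^sub>\<infinity>i\<in>I. f i x) \<in> borel_measurable M"
proof -
  interpret sigma_finite_measure "count_space I"
    by (rule sigma_finite_measure_count_space_countable[OF I])
  show ?thesis
    unfolding infsum_eq_integral
    by (rule borel_measurable_lebesgue_integral[OF measurable_pair_count_space[OF I f]])
qed

text \<open>This Hajlasz-type bound is what is used of the continuity of translations; it also
  handles differences \<open>f u - f v\<close> in which \<open>u - v\<close> is not constant.\<close>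

definition small_osc :: "real \<Rightarrow> ('a::euclidean_space \<Rightarrow> complex) \<Rightarrow> bool" where
  "small_osc p f \<longleftrightarrow> (\<forall>e>0. \<exists>d>0. \<exists>\<phi> \<in> borel_measurable lebesgue. (\<integral>\<^sup>+x. \<phi> x \<partial>lebesgue) \<le> ennreal e \<and>
     (\<forall>u v. dist u v \<le> d \<longrightarrow> pabs p (f u - f v) \<le> \<phi> u + \<phi> v))"

context
  fixes p :: real
  assumes p: "0 < p" "p \<le> 1"
begin

lemma small_osc_zero: "small_osc p (\<lambda>x. 0)"
  unfolding small_osc_def
proof (intro allI impI)
  fix e :: real assume "0 < e"
  show "\<exists>d>0. \<exists>\<phi> \<in> borel_measurable lebesgue. (\<integral>\<^sup>+(x::'a). \<phi> x \<partial>lebesgue) \<le> ennreal e \<and>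
     (\<forall>u v. dist u v \<le> d \<longrightarrow> pabs p (0 - 0) \<le> \<phi> u + \<phi> v)"
    by (intro exI[of _ 1] conjI bexI[of _ "\<lambda>_. 0"]) auto
qed

lemma small_osc_add:
  assumes "small_osc p f" "small_osc p g"
  shows "small_osc p (\<lambda>x. f x + g x)"
  unfolding small_osc_def
proof (intro allI impI)
  fix e :: real assume "0 < e"
  then have e: "0 < e / 2" by simp
  obtain d \<phi> where d: "d > 0" "\<phi> \<in> borel_measurable lebesgue" "(\<integral>\<^sup>+x. \<phi> x \<partial>lebesgue) \<le> ennreal (e / 2)"
    "\<And>u v. dist u v \<le> d \<Longrightarrow> pabs p (f u - f v) \<le> \<phi> u + \<phi> v"
    using assms(1) e unfolding small_osc_def by meson
  obtain d' \<phi>' where d': "d' > 0" "\<phi>' \<in> borel_measurable lebesgue" "(\<integral>\<^sup>+x. \<phi>' x \<partial>lebesgue) \<le> ennreal (e / 2)"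
    "\<And>u v. dist u v \<le> d' \<Longrightarrow> pabs p (g u - g v) \<le> \<phi>' u + \<phi>' v"
    using assms(2) e unfolding small_osc_def by meson
  show "\<exists>d>0. \<exists>\<phi> \<in> borel_measurable lebesgue. (\<integral>\<^sup>+x. \<phi> x \<partial>lebesgue) \<le> ennreal e \<and>
     (\<forall>u v. dist u v \<le> d \<longrightarrow> pabs p (f u + g u - (f v + g v)) \<le> \<phi> u + \<phi> v)"
  proof (intro exI[of _ "min d d'"] conjI bexI[of _ "\<lambda>x. \<phi> x + \<phi>' x"] allI impI)
    have "(\<integral>\<^sup>+x. \<phi> x + \<phi>' x \<partial>lebesgue) \<le> ennreal (e / 2) + ennreal (e / 2)"
      using d d' by (simp add: nn_integral_add add_mono)
    then show "(\<integral>\<^sup>+x. \<phi> x + \<phi>' x \<partial>lebesgue) \<le> ennreal e"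
      using \<open>0 < e\<close> by (simp flip: ennreal_plus)
    fix u v :: 'a assume uv: "dist u v \<le> min d d'"
    have "pabs p (f u + g u - (f v + g v)) \<le> pabs p (f u - f v) + pabs p (g u - g v)"
      using pabs_add_le[OF p, of "f u - f v" "g u - g v"] by (simp add: algebra_simps)
    also have "\<dots> \<le> (\<phi> u + \<phi> v) + (\<phi>' u + \<phi>' v)"
      using uv by (intro add_mono d d') auto
    finally show "pabs p (f u + g u - (f v + g v)) \<le> \<phi> u + \<phi>' u + (\<phi> v + \<phi>' v)"
      by (simp add: ac_simps)
  qed (use d d' in auto)
qed

lemma small_osc_sum:
  assumes "finite Z" "\<And>z. z \<in> Z \<Longrightarrow> small_osc p (f z)"
  shows "small_osc p (\<lambda>x. \<Sum>z\<in>Z. f z x)"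
  using assms by (induction Z) (simp_all add: small_osc_zero small_osc_add)

text \<open>In f u - f v = (f u - g u) + (g u - g v) + (g v - f v) the outer terms are values at
  \<open>u\<close> and at \<open>v\<close> of the single function \<open>pabs p (f x - g x)\<close>,
  which has small integral. It can be added to the majorant of \<open>g\<close>.\<close>

lemma small_osc_limit:
  assumes "\<And>e::real. e > 0 \<Longrightarrow> \<exists>g. small_osc p g \<and> (\<lambda>x. f x - g x) \<in> borel_measurable lebesgue \<and>
    (\<integral>\<^sup>+x. pabs p (f x - g x) \<partial>lebesgue) \<le> ennreal e"
  shows "small_osc p f"
  unfolding small_osc_def
proof (intro allI impI)
  fix e :: real assume "0 < e"
  then have e: "0 < e / 2" by simp
  obtain g where g: "small_osc p g" "(\<lambda>x. f x - g x) \<in> borel_measurable lebesgue"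
    "(\<integral>\<^sup>+x. pabs p (f x - g x) \<partial>lebesgue) \<le> ennreal (e / 2)"
    using assms[OF e] by blast
  obtain d \<phi> where d: "d > 0" "\<phi> \<in> borel_measurable lebesgue" "(\<integral>\<^sup>+x. \<phi> x \<partial>lebesgue) \<le> ennreal (e / 2)"
    "\<And>u v. dist u v \<le> d \<Longrightarrow> pabs p (g u - g v) \<le> \<phi> u + \<phi> v"
    using g(1) e unfolding small_osc_def by meson
  have m: "(\<lambda>x. pabs p (f x - g x)) \<in> borel_measurable lebesgue"
    by (rule measurable_compose[OF g(2) measurable_pabs])
  show "\<exists>d>0. \<exists>\<phi> \<in> borel_measurable lebesgue. (\<integral>\<^sup>+x. \<phi> x \<partial>lebesgue) \<le> ennreal e \<and>
     (\<forall>u v. dist u v \<le> d \<longrightarrow> pabs p (f u - f v) \<le> \<phi> u + \<phi> v)"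
  proof (intro exI[of _ d] conjI bexI[of _ "\<lambda>x. pabs p (f x - g x) + \<phi> x"] allI impI)
    have "(\<integral>\<^sup>+x. pabs p (f x - g x) + \<phi> x \<partial>lebesgue) \<le> ennreal (e / 2) + ennreal (e / 2)"
      using d g m by (simp add: nn_integral_add add_mono)
    then show "(\<integral>\<^sup>+x. pabs p (f x - g x) + \<phi> x \<partial>lebesgue) \<le> ennreal e"
      using \<open>0 < e\<close> by (simp flip: ennreal_plus)
    fix u v :: 'a assume uv: "dist u v \<le> d"
    have "pabs p (f u - f v) \<le> pabs p (f u - g u) + pabs p (g u - f v)"
      by (rule pabs_diff_triangle[OF p])
    also have "\<dots> \<le> pabs p (f u - g u) + (pabs p (g u - g v) + pabs p (g v - f v))"
      by (intro add_mono order_refl pabs_diff_triangle[OF p])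
    also have "\<dots> \<le> pabs p (f u - g u) + ((\<phi> u + \<phi> v) + pabs p (f v - g v))"
      using uv by (intro add_mono order_refl d(4)) (simp_all add: pabs_minus_commute)
    finally show "pabs p (f u - f v) \<le> pabs p (f u - g u) + \<phi> u + (pabs p (f v - g v) + \<phi> v)"
      by (simp add: ac_simps)
  qed (use d m in auto)
qed

text \<open>Regularity gives K \<subseteq> A \<subseteq> U with \<open>K\<close> compact,
  \<open>U\<close> open and U - K of small measure. The set \<open>K\<close> has positive distance
  \<open>d\<close> from the complement of \<open>U\<close>. If two points closer than
  \<open>d\<close> are separated by \<open>A\<close>, at least one of them lies in U - K, where the
  majorant has the constant value \<open>pabs p z\<close>.\<close>

lemma small_osc_indicator:
  fixes A :: "'a::euclidean_space set"
  assumes A: "A \<in> sets lebesgue" "bounded A"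
  shows "small_osc p (\<lambda>x. z * indicator A x)"
  unfolding small_osc_def
proof (intro allI impI)
  fix e :: real assume "0 < e"
  \<comment> \<open>Adding 1 keeps the divisor of \<open>r\<close> positive when \<open>z\<close> is
    0; the two thin sets then contribute at most \<open>norm z powr p * (2 * r)\<close>, hence at
    most \<open>e\<close>.\<close>
  define t where "t = norm z powr p + 1"
  have t: "t > 0" by (simp add: t_def add_nonneg_pos)
  define r where "r = e / (2 * t)"
  have r: "r > 0" "t * (2 * r) = e" using \<open>0 < e\<close> t by (simp_all add: r_def)
  obtain U where U: "open U" "A \<subseteq> U" "U - A \<in> lmeasurable" "emeasure lebesgue (U - A) < ennreal r"
    using sets_lebesgue_outer_open[OF A(1) r(1)] .
  obtain K where K: "closed K" "K \<subseteq> A" "A - K \<in> lmeasurable" "emeasure lebesgue (A - K) < ennreal r"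
    using sets_lebesgue_inner_closed[OF A(1) r(1)] .
  have "compact K" using K A(2) by (simp add: compact_eq_bounded_closed bounded_subset)
  moreover have "closed (- U)" "K \<inter> - U = {}" using U(1,2) K(2) by auto
  ultimately obtain d where d: "d > 0" "\<And>x y. x \<in> K \<Longrightarrow> y \<in> - U \<Longrightarrow> d \<le> dist x y"
    using separate_compact_closed[of K "- U"] by blast
  let ?\<phi> = "\<lambda>x. pabs p z * indicator ((U - A) \<union> (A - K)) x"
  have sets: "(U - A) \<union> (A - K) \<in> sets lebesgue" using U(3) K(3) by auto
  show "\<exists>d>0. \<exists>\<phi> \<in> borel_measurable lebesgue. (\<integral>\<^sup>+x. \<phi> x \<partial>lebesgue) \<le> ennreal e \<and>
     (\<forall>u v. dist u v \<le> d \<longrightarrow> pabs p (z * indicator A u - z * indicator A v) \<le> \<phi> u + \<phi> v)"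
  proof (intro exI[of _ "d / 2"] conjI bexI[of _ ?\<phi>] allI impI)
    have "(\<integral>\<^sup>+x. ?\<phi> x \<partial>lebesgue) = pabs p z * emeasure lebesgue ((U - A) \<union> (A - K))"
      by (rule nn_integral_cmult_indicator[OF sets])
    also have "\<dots> \<le> pabs p z * (emeasure lebesgue (U - A) + emeasure lebesgue (A - K))"
      using U(3) K(3) by (intro mult_left_mono emeasure_subadditive fmeasurableD) auto
    also have "\<dots> \<le> pabs p z * (ennreal r + ennreal r)"
      using U(4) K(4) by (intro mult_left_mono add_mono) auto
    also have "\<dots> = ennreal (norm z powr p * (2 * r))"
      using r by (simp add: pabs_def ennreal_mult flip: ennreal_plus)
    also have "\<dots> \<le> ennreal e"
    proof (rule ennreal_leI)
      have "norm z powr p * (2 * r) \<le> t * (2 * r)"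
        using r(1) by (intro mult_right_mono) (simp_all add: t_def)
      also note r(2)
      finally show "norm z powr p * (2 * r) \<le> e" .
    qed
    finally show "(\<integral>\<^sup>+x. ?\<phi> x \<partial>lebesgue) \<le> ennreal e" .
    have half: "pabs p (z * indicator A u - z * indicator A v) \<le> ?\<phi> u + ?\<phi> v"
      if "dist u v \<le> d / 2" "u \<in> A" "v \<notin> A" for u v
    proof -
      have "u \<notin> K \<or> v \<in> U" using d(2)[of u v] that(1) d(1) by fastforce
      then have "u \<in> (U - A) \<union> (A - K) \<or> v \<in> (U - A) \<union> (A - K)" using that by blast
      then have "pabs p z \<le> ?\<phi> u + ?\<phi> v"
        by (elim disjE) (simp_all add: indicator_def)
      then show ?thesis using that by simp
    qed
    fix u v :: 'a assume uv: "dist u v \<le> d / 2"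
    consider "u \<in> A" "v \<notin> A" | "v \<in> A" "u \<notin> A" | "u \<in> A \<longleftrightarrow> v \<in> A" by blast
    then show "pabs p (z * indicator A u - z * indicator A v) \<le> ?\<phi> u + ?\<phi> v"
    proof cases
      case 2
      then have "pabs p (z * indicator A v - z * indicator A u) \<le> ?\<phi> v + ?\<phi> u"
        using uv by (intro half) (simp_all add: dist_commute)
      then show ?thesis
        by (subst pabs_minus_commute, subst add.commute)
    qed (use half uv in \<open>auto simp: indicator_def\<close>)
  qed (use d sets in auto)
qed

text \<open>Simple functions \<open>F i\<close> converging to \<open>f\<close> with norm at most 2
  norm f, cut off to balls, are finite sums of multiples of indicators of bounded sets. At each
  point the cutoff is eventually inactive, and three times the p-th power of norm f dominates the
  p-th power of the difference, so dominated convergence gives approximation in the p-th power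
  distance.\<close>

lemma small_osc_Lp:
  fixes f :: "'a::euclidean_space \<Rightarrow> complex"
  assumes "f \<in> Lp_fun lebesgue p"
  shows "small_osc p f"
proof (rule small_osc_limit)
  fix e :: real assume e: "0 < e"
  have f: "f \<in> borel_measurable lebesgue" and fin: "(\<integral>\<^sup>+x. pabs p (f x) \<partial>lebesgue) < \<infinity>"
    using assms by (auto simp: Lp_fun_iff)
  have fm: "(\<lambda>x. pabs p (f x)) \<in> borel_measurable lebesgue"
    by (rule measurable_compose[OF f measurable_pabs])
  obtain F where F: "\<And>i. simple_function lebesgue (F i)" "\<And>x. (\<lambda>i. F i x) \<longlonglongrightarrow> f x"
    "\<And>i x. norm (F i x) \<le> 2 * norm (f x)"
    using borel_measurable_implies_sequence_metric[OF f, of 0] by auto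
  define G where "G i x = F i x * indicator (cball 0 (real i)) x" for i x
  have Fm: "F i \<in> borel_measurable lebesgue" for i
    using F(1) by (rule borel_measurable_simple_function)
  have Gm: "G i \<in> borel_measurable lebesgue" for i
    unfolding G_def by (intro borel_measurable_times Fm borel_measurable_indicator) auto
  have "small_osc p (G i)" for i
  proof -
    have fin: "finite (range (F i))" using F(1)[of i] by (simp add: simple_function_def)
    let ?A = "\<lambda>z. F i -` {z} \<inter> cball 0 (real i)"
    have A: "?A z \<in> sets lebesgue" for z
      using measurable_sets[OF Fm[of i], of "{z}"] by (intro sets.Int) auto
    have "small_osc p (\<lambda>x. \<Sum>z\<in>range (F i). z * indicator (?A z) x)"
      by (intro small_osc_sum small_osc_indicator fin A) (simp add: bounded_Int)
    moreover have "(\<Sum>z\<in>range (F i). z * indicator (?A z) x) = G i x" for x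
    proof -
      have "(\<Sum>z\<in>range (F i). z * indicator (?A z) x) =
          (\<Sum>z\<in>range (F i). if z = F i x then F i x * indicator (cball 0 (real i)) x else 0)"
        by (intro sum.cong) (auto simp: indicator_def)
      then show ?thesis using fin by (simp add: G_def)
    qed
    ultimately show ?thesis by simp
  qed
  moreover have "(\<lambda>i. \<integral>\<^sup>+x. pabs p (f x - G i x) \<partial>lebesgue) \<longlonglongrightarrow> (\<integral>\<^sup>+(x::'a). 0 \<partial>lebesgue)"
  proof (rule nn_integral_dominated_convergence[where w="\<lambda>x. pabs p (f x) + (pabs p (f x) + pabs p (f x))"])
    show "(\<lambda>x. pabs p (f x - G i x)) \<in> borel_measurable lebesgue" for i
      by (rule measurable_compose[OF borel_measurable_diff[OF f Gm] measurable_pabs])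
    show "(\<lambda>x. pabs p (f x) + (pabs p (f x) + pabs p (f x))) \<in> borel_measurable lebesgue"
      by (rule borel_measurable_add[OF fm borel_measurable_add[OF fm fm]])
    show "AE x in lebesgue. pabs p (f x - G i x) \<le> pabs p (f x) + (pabs p (f x) + pabs p (f x))" for i
    proof (rule AE_I2)
      fix x
      have "pabs p (G i x) \<le> pabs p (2 * f x)"
        using F(3)[of i x] by (intro pabs_mono[OF p]) (auto simp: G_def indicator_def norm_mult)
      also have "\<dots> \<le> pabs p (f x) + pabs p (f x)"
        unfolding mult_2 by (rule pabs_add_le[OF p])
      finally show "pabs p (f x - G i x) \<le> pabs p (f x) + (pabs p (f x) + pabs p (f x))"
        by (rule order_trans[OF pabs_diff_le[OF p] add_left_mono])
    qed
    show "(\<integral>\<^sup>+x. pabs p (f x) + (pabs p (f x) + pabs p (f x)) \<partial>lebesgue) < \<infinity>"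
      using fin by (simp only: nn_integral_add fm borel_measurable_add) simp
    show "AE x in lebesgue. (\<lambda>i. pabs p (f x - G i x)) \<longlonglongrightarrow> 0"
    proof (rule AE_I2)
      fix x :: 'a
      have "eventually (\<lambda>i. norm x \<le> real i) sequentially"
        by (rule eventually_sequentiallyI[of "nat \<lceil>norm x\<rceil>"]) linarith
      then have "eventually (\<lambda>i. F i x = G i x) sequentially"
        by eventually_elim (simp add: G_def)
      then have "(\<lambda>i. G i x) \<longlonglongrightarrow> f x" using F(2) by (rule Lim_transform_eventually[rotated])
      then have "(\<lambda>i. norm (f x - G i x) powr p) \<longlonglongrightarrow> norm (f x - f x) powr p"
        using p by (intro tendsto_powr' tendsto_intros) auto
      then have "(\<lambda>i. ennreal (norm (f x - G i x) powr p)) \<longlonglongrightarrow> ennreal 0"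
        by (intro tendsto_ennrealI) simp
      then show "(\<lambda>i. pabs p (f x - G i x)) \<longlonglongrightarrow> 0" by (simp add: pabs_def)
    qed
  qed simp
  then have "eventually (\<lambda>i. (\<integral>\<^sup>+x. pabs p (f x - G i x) \<partial>lebesgue) < ennreal e) sequentially"
    using e by (intro order_tendstoD(2)) auto
  then obtain i where "(\<integral>\<^sup>+x. pabs p (f x - G i x) \<partial>lebesgue) < ennreal e"
    unfolding eventually_sequentially by blast
  ultimately show "\<exists>g. small_osc p g \<and> (\<lambda>x. f x - g x) \<in> borel_measurable lebesgue \<and>
      (\<integral>\<^sup>+x. pabs p (f x - g x) \<partial>lebesgue) \<le> ennreal e"
    by (intro exI[of _ "G i"] conjI less_imp_le borel_measurable_diff f Gm)
qed

end

section \<open>Synthesis at a single scale\<close>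

lemma borel_measurable_nn_integral_count_space:
  fixes f :: "'i \<Rightarrow> 'a \<Rightarrow> ennreal"
  assumes I: "countable I" and f: "\<And>i. i \<in> I \<Longrightarrow> f i \<in> borel_measurable M"
  shows "(\<lambda>x. \<integral>\<^sup>+i. f i x \<partial>count_space I) \<in> borel_measurable M"
proof -
  interpret sigma_finite_measure "count_space I"
    by (rule sigma_finite_measure_count_space_countable[OF I])
  show ?thesis
    by (rule borel_measurable_nn_integral[OF measurable_pair_count_space[OF I f]])
qed

lemma measurable_cube: "F \<in> borel_measurable lebesgue \<Longrightarrow> F \<in> borel_measurable (lebesgue_on unit_cube)"
  by (rule measurable_restrict_space1)

lemma cube_integral_const: "cube_integral (\<lambda>x :: real ^ 'n. c) = c"
  unfolding cube_integral_eq nn_integral_cmult_indicator[OF sets_unit_cube] emeasure_unit_cube by simp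

lemma measurable_matrix_add_lebesgue:
  fixes T :: "real ^ 'n ^ 'n"
  assumes "invertible T" "F \<in> borel_measurable lebesgue"
  shows "(\<lambda>x. F (T *v (x + c))) \<in> borel_measurable lebesgue"
  by (rule measurable_compose[OF measurable_add_lebesgue
        measurable_compose[OF measurable_matrix_lebesgue[OF assms(1)] assms(2)]])

text \<open>All of this is the tiling in the coordinates x = T(y + m). With the sum outside, it cuts
  an integral into cells, as needed for the reconstruction error. With the sum inside, it says that
  a normalized lattice sum has the integral as its exact mean over the offset.\<close>

lemma
  fixes T :: "real ^ 'n ^ 'n"
  assumes T: "invertible T" and F: "F \<in> borel_measurable lebesgue"
  shows nn_integral_unfold: "(\<integral>\<^sup>+x. F x \<partial>lebesgue) =
      \<bar>det T\<bar> * (\<integral>\<^sup>+m. cube_integral (\<lambda>x. F (T *v (x + int_vec m))) \<partial>count_space UNIV)"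
    and cube_integral_unfold: "cube_integral (\<lambda>x. \<bar>det T\<bar> * (\<integral>\<^sup>+m. F (T *v (x + int_vec m)) \<partial>count_space UNIV)) =
      (\<integral>\<^sup>+x. F x \<partial>lebesgue)"
    and measurable_unfold: "(\<lambda>x. \<bar>det T\<bar> * (\<integral>\<^sup>+m. F (T *v (x + int_vec m)) \<partial>count_space UNIV))
      \<in> borel_measurable lebesgue"
proof -
  note m = measurable_matrix_add_lebesgue[OF T F]
  have ms: "(\<lambda>x. \<integral>\<^sup>+m. F (T *v (x + int_vec m)) \<partial>count_space UNIV) \<in> borel_measurable lebesgue"
    by (rule borel_measurable_nn_integral_count_space[OF countableI_type m])
  then show "(\<lambda>x. \<bar>det T\<bar> * (\<integral>\<^sup>+m. F (T *v (x + int_vec m)) \<partial>count_space UNIV)) \<in> borel_measurable lebesgue"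
    by (intro borel_measurable_times_ennreal borel_measurable_const)
  show eq: "(\<integral>\<^sup>+x. F x \<partial>lebesgue) =
      \<bar>det T\<bar> * (\<integral>\<^sup>+m. cube_integral (\<lambda>x. F (T *v (x + int_vec m))) \<partial>count_space UNIV)"
    unfolding nn_integral_matrix_lebesgue[OF T F]
    by (subst nn_integral_tiling)
      (rule measurable_compose[OF measurable_matrix_lebesgue[OF T] F], rule refl)
  have "cube_integral (\<lambda>x. \<bar>det T\<bar> * (\<integral>\<^sup>+m. F (T *v (x + int_vec m)) \<partial>count_space UNIV)) =
      \<bar>det T\<bar> * cube_integral (\<lambda>x. \<integral>\<^sup>+m. F (T *v (x + int_vec m)) \<partial>count_space UNIV)"
    by (rule nn_integral_cmult[OF measurable_cube[OF ms]])
  also have "cube_integral (\<lambda>x. \<integral>\<^sup>+m. F (T *v (x + int_vec m)) \<partial>count_space UNIV) =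
      (\<integral>\<^sup>+m. cube_integral (\<lambda>x. F (T *v (x + int_vec m))) \<partial>count_space UNIV)"
    by (rule nn_integral_count_space_nn_integral[OF countableI_type measurable_cube[OF m]])
  finally show "cube_integral (\<lambda>x. \<bar>det T\<bar> * (\<integral>\<^sup>+m. F (T *v (x + int_vec m)) \<partial>count_space UNIV)) =
      (\<integral>\<^sup>+x. F x \<partial>lebesgue)"
    unfolding eq .
qed

lemma int_vec_diff: "int_vec (m - l) = int_vec m - int_vec l"
  by (simp add: int_vec_def vec_eq_iff)

lemma int_vec_minus: "int_vec (- l) = - int_vec l"
  by (simp add: int_vec_def vec_eq_iff)

text \<open>Here \<open>F\<close> is the value of the function at a point, \<open>G\<close> its value at the nearby lattice point and
  \<open>H l\<close> its values at the other lattice points. If the last series diverges, then \<open>\<Sum>\<^sub>\<infinity>\<close> on the left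
  may be the junk value \<open>0\<close>, but the right-hand side is infinite or \<open>\<mu> = 0\<close>.\<close>

lemma pabs_reconstruction_error:
  assumes p: "0 < p" "p \<le> 1" and q: "(\<integral>\<^sup>+l. pabs p (q l) \<partial>count_space UNIV) < \<infinity>"
  shows "pabs p (F - \<mu> * (\<Sum>\<^sub>\<infinity>l. H l * q l)) \<le>
    pabs p (F - G) + pabs p G * pabs p (\<mu> * (\<Sum>\<^sub>\<infinity>l. q l) - 1) +
    pabs p \<mu> * (\<integral>\<^sup>+l. pabs p (G - H l) * pabs p (q l) \<partial>count_space UNIV)" (is "_ \<le> ?R")
proof (cases "(\<integral>\<^sup>+l. pabs p ((G - H l) * q l) \<partial>count_space UNIV) < \<infinity>")
  case True
  define Q E where "Q = (\<Sum>\<^sub>\<infinity>l. q l)" and "E = (\<Sum>\<^sub>\<infinity>l. (G - H l) * q l)"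
  note sm = pabs_summable(2)[OF p q] pabs_summable(2)[OF p True]
  have "(\<Sum>\<^sub>\<infinity>l. H l * q l) = (\<Sum>\<^sub>\<infinity>l. G * q l + - ((G - H l) * q l))"
    by (intro infsum_cong) (simp add: algebra_simps)
  also have "\<dots> = (\<Sum>\<^sub>\<infinity>l. G * q l) + (\<Sum>\<^sub>\<infinity>l. - ((G - H l) * q l))"
    by (intro infsum_add summable_on_cmult_right sm) (simp add: summable_on_uminus sm)
  also have "\<dots> = G * Q - E"
    using infsum_cmult_right[of G q UNIV] sm(1) by (simp add: infsum_uminus Q_def E_def)
  finally have "(\<Sum>\<^sub>\<infinity>l. H l * q l) = G * Q - E" .
  then have eq: "F - \<mu> * (\<Sum>\<^sub>\<infinity>l. H l * q l) = (F - G) - G * (\<mu> * Q - 1) + \<mu> * E"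
    by (simp only:) (simp add: algebra_simps)
  have "pabs p (F - \<mu> * (\<Sum>\<^sub>\<infinity>l. H l * q l)) \<le>
      pabs p (F - G) + pabs p (G * (\<mu> * Q - 1)) + pabs p (\<mu> * E)"
    unfolding eq
    by (rule order_trans[OF pabs_add_le[OF p]]) (intro add_mono order_refl pabs_diff_le[OF p])
  also have "\<dots> \<le> ?R"
    unfolding pabs_mult Q_def E_def using pabs_infsum_le[OF p, of "\<lambda>l. (G - H l) * q l" UNIV]
    by (intro add_mono mult_left_mono) (simp_all add: pabs_mult)
  finally show ?thesis .
next
  case False
  then have top: "(\<integral>\<^sup>+l. pabs p (G - H l) * pabs p (q l) \<partial>count_space UNIV) = top"
    by (simp add: pabs_mult not_less top_unique)
  show ?thesis
  proof (cases "\<mu> = 0")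
    case True
    then show ?thesis
      using pabs_add_le[OF p, of "F - G" G] by (simp add: pabs_def)
  next
    case False
    then have "pabs p \<mu> * top = top" by (simp add: ennreal_mult_top pabs_eq_0_iff)
    then show ?thesis unfolding top by simp
  qed
qed

locale affine_system =
  fixes a :: "nat \<Rightarrow> real ^ 'n ^ 'n" and b :: "real ^ 'n ^ 'n"
    and p :: real and \<psi> :: "real ^ 'n \<Rightarrow> complex"
  assumes inv_a: "\<And>j. 0 < j \<Longrightarrow> invertible (a j)"
    and lim_a: "(\<lambda>j. onorm (\<lambda>x. matrix_inv (a j) *v x)) \<longlonglongrightarrow> 0"
    and inv_b: "invertible b"
    and p: "0 < p" "p \<le> 1"
    and \<psi>: "\<psi> \<in> Lp_fun lebesgue p"
begin

abbreviation W :: "nat \<times> (int ^ 'n) \<Rightarrow> real ^ 'n \<Rightarrow> complex" where "W \<equiv> wavelet a b p \<psi>"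

definition synth :: "(nat \<times> (int ^ 'n) \<Rightarrow> complex) \<Rightarrow> real ^ 'n \<Rightarrow> complex" where
  "synth c x = (\<Sum>\<^sub>\<infinity>i\<in>scales. c i * W i x)"

lemma synthesis_eq: "synthesis a b p \<psi> c = Lp_class lebesgue p (synth c)"
  by (simp add: synthesis_def synth_def[abs_def])

lemma \<psi>_measurable: "\<psi> \<in> borel_measurable lebesgue"
  using \<psi> by (simp add: Lp_fun_iff)

lemma pabs_\<psi>_measurable: "(\<lambda>x. pabs p (\<psi> x)) \<in> borel_measurable lebesgue"
  by (rule measurable_compose[OF \<psi>_measurable measurable_pabs])

lemma countable_scales: "countable scales"
  by (rule countableI_type)

text \<open>The factor \<open>\<bar>det (a j)\<bar> powr (1/p)\<close> is the normalization in
  p-norm: its p-th power is the Jacobian of the dilation, so all wavelets have the norm of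
  \<psi>.\<close>

lemma
  assumes "i \<in> scales"
  shows W_measurable: "W i \<in> borel_measurable lebesgue"
    and nn_integral_pabs_W: "(\<integral>\<^sup>+x. pabs p (W i x) \<partial>lebesgue) = (\<integral>\<^sup>+x. pabs p (\<psi> x) \<partial>lebesgue)"
proof -
  obtain j k where i: "i = (j, k)" "0 < j" using assms by (cases i) (auto simp: scales_def)
  note inv = inv_a[OF i(2)]
  let ?A = "\<bar>det (a j)\<bar>" and ?c = "- (b *v int_vec k)"
  have W: "W i x = of_real (?A powr (1/p)) * \<psi> (a j *v x + ?c)" for x
    by (simp add: wavelet_def i(1))
  note m = measurable_compose[OF measurable_matrix_lebesgue[OF inv] measurable_compose[OF measurable_add_lebesgue \<psi>_measurable]]
  show "W i \<in> borel_measurable lebesgue"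
    unfolding W[abs_def] by (intro borel_measurable_times borel_measurable_const m)
  have A: "pabs p (of_real (?A powr (1/p))) = ennreal ?A"
    using p by (simp add: pabs_def powr_powr)
  have "(\<integral>\<^sup>+x. pabs p (\<psi> x) \<partial>lebesgue) = (\<integral>\<^sup>+x. pabs p (\<psi> (x + ?c)) \<partial>lebesgue)"
    by (rule nn_integral_add_lebesgue[OF pabs_\<psi>_measurable, symmetric])
  also have "\<dots> = ?A * (\<integral>\<^sup>+x. pabs p (\<psi> (a j *v x + ?c)) \<partial>lebesgue)"
    by (rule nn_integral_matrix_lebesgue[OF inv measurable_compose[OF measurable_add_lebesgue pabs_\<psi>_measurable]])
  also have "\<dots> = (\<integral>\<^sup>+x. pabs p (W i x) \<partial>lebesgue)"
    unfolding W pabs_mult A by (rule nn_integral_cmult[symmetric], rule measurable_compose[OF m measurable_pabs])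
  finally show "(\<integral>\<^sup>+x. pabs p (W i x) \<partial>lebesgue) = (\<integral>\<^sup>+x. pabs p (\<psi> x) \<partial>lebesgue)" ..
qed

text \<open>By Tonelli and the normalization of the wavelets, the integral is the sum of the p-th
  powers of the coefficients times that of the norm of \<psi>. The index map allows repeated
  wavelets: it is the identity for a single synthesis, and \<open>snd\<close> on pairs (step,
  wavelet) for the double series of the iteration.\<close>

lemma
  assumes K: "countable K" and \<iota>: "\<And>k. k \<in> K \<Longrightarrow> \<iota> k \<in> scales"
    and fin: "(\<integral>\<^sup>+k. pabs p (e k) \<partial>count_space K) < \<infinity>"
  shows nn_integral_superposition: "(\<integral>\<^sup>+x. \<integral>\<^sup>+k. pabs p (e k * W (\<iota> k) x) \<partial>count_space K \<partial>lebesgue) < \<infinity>"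
    and AE_superposition: "AE x in lebesgue. (\<integral>\<^sup>+k. pabs p (e k * W (\<iota> k) x) \<partial>count_space K) < \<infinity>"
proof -
  have m: "(\<lambda>x. pabs p (e k * W (\<iota> k) x)) \<in> borel_measurable lebesgue" if "k \<in> K" for k
    by (intro measurable_compose[OF _ measurable_pabs] borel_measurable_times borel_measurable_const W_measurable \<iota> that)
  have N: "(\<integral>\<^sup>+x. pabs p (\<psi> x) \<partial>lebesgue) < \<infinity>" using \<psi> by (simp add: Lp_fun_iff)
  have "(\<integral>\<^sup>+x. \<integral>\<^sup>+k. pabs p (e k * W (\<iota> k) x) \<partial>count_space K \<partial>lebesgue) =
      (\<integral>\<^sup>+k. \<integral>\<^sup>+x. pabs p (e k * W (\<iota> k) x) \<partial>lebesgue \<partial>count_space K)"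
    by (rule nn_integral_count_space_nn_integral[OF K m])
  also have "\<dots> = (\<integral>\<^sup>+k. pabs p (e k) * (\<integral>\<^sup>+x. pabs p (\<psi> x) \<partial>lebesgue) \<partial>count_space K)"
  proof (rule nn_integral_cong)
    fix k assume "k \<in> space (count_space K)"
    then have i: "\<iota> k \<in> scales" using \<iota> by simp
    have "(\<lambda>x. pabs p (W (\<iota> k) x)) \<in> borel_measurable lebesgue"
      by (rule measurable_compose[OF W_measurable[OF i] measurable_pabs])
    then show "(\<integral>\<^sup>+x. pabs p (e k * W (\<iota> k) x) \<partial>lebesgue) = pabs p (e k) * (\<integral>\<^sup>+x. pabs p (\<psi> x) \<partial>lebesgue)"
      unfolding pabs_mult nn_integral_pabs_W[OF i, symmetric] by (rule nn_integral_cmult)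
  qed
  also have "\<dots> = (\<integral>\<^sup>+k. pabs p (e k) \<partial>count_space K) * (\<integral>\<^sup>+x. pabs p (\<psi> x) \<partial>lebesgue)"
    by (rule nn_integral_multc) simp
  also have "\<dots> < \<infinity>" using fin N by (simp add: ennreal_mult_less_top)
  finally show fin': "(\<integral>\<^sup>+x. \<integral>\<^sup>+k. pabs p (e k * W (\<iota> k) x) \<partial>count_space K \<partial>lebesgue) < \<infinity>" .
  have "AE x in lebesgue. (\<integral>\<^sup>+k. pabs p (e k * W (\<iota> k) x) \<partial>count_space K) \<noteq> \<infinity>"
    using fin' by (intro nn_integral_PInf_AE borel_measurable_nn_integral_count_space K m) auto
  then show "AE x in lebesgue. (\<integral>\<^sup>+k. pabs p (e k * W (\<iota> k) x) \<partial>count_space K) < \<infinity>"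
    by eventually_elim (simp add: less_top)
qed

lemma AE_synth_summable:
  assumes "c \<in> ell scales p"
  shows "AE x in lebesgue. (\<lambda>i. c i * W i x) summable_on scales"
proof -
  have "AE x in lebesgue. (\<integral>\<^sup>+i. pabs p (c i * W i x) \<partial>count_space scales) < \<infinity>"
    using assms by (intro AE_superposition countable_scales) (simp_all add: ell_iff)
  then show ?thesis by eventually_elim (rule pabs_summable(2)[OF p])
qed

lemma synth_measurable: "synth c \<in> borel_measurable lebesgue"
  unfolding synth_def[abs_def]
  by (intro borel_measurable_infsum countable_scales borel_measurable_times borel_measurable_const W_measurable)

lemma synth_Lp:
  assumes "c \<in> ell scales p"
  shows "synth c \<in> Lp_fun lebesgue p"
proof -
  have "(\<integral>\<^sup>+x. pabs p (synth c x) \<partial>lebesgue) \<le>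
      (\<integral>\<^sup>+x. \<integral>\<^sup>+i. pabs p (c i * W i x) \<partial>count_space scales \<partial>lebesgue)"
    unfolding synth_def by (intro nn_integral_mono pabs_infsum_le p)
  also have "\<dots> < \<infinity>"
    using assms by (intro nn_integral_superposition countable_scales) (simp_all add: ell_iff)
  finally show ?thesis by (simp add: Lp_fun_iff synth_measurable)
qed

lemma ell_add:
  assumes "c \<in> ell I p" "c' \<in> ell I p"
  shows "(\<lambda>i. c i + c' i) \<in> ell I p"
proof -
  have "(\<integral>\<^sup>+i. pabs p (c i + c' i) \<partial>count_space I) \<le> (\<integral>\<^sup>+i. pabs p (c i) + pabs p (c' i) \<partial>count_space I)"
    by (intro nn_integral_mono pabs_add_le p)
  also have "\<dots> = (\<integral>\<^sup>+i. pabs p (c i) \<partial>count_space I) + (\<integral>\<^sup>+i. pabs p (c' i) \<partial>count_space I)"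
    by (rule nn_integral_add) simp_all
  also have "\<dots> < \<infinity>" using assms by (simp add: ell_iff)
  finally show ?thesis using assms by (simp add: ell_iff)
qed

lemma AE_synth_add:
  assumes "c \<in> ell scales p" "c' \<in> ell scales p"
  shows "AE x in lebesgue. synth (\<lambda>i. c i + c' i) x = synth c x + synth c' x"
  using AE_synth_summable[OF assms(1)] AE_synth_summable[OF assms(2)]
  by eventually_elim (simp add: synth_def distrib_right infsum_add)


section \<open>Sampling lattice and periodization in cell coordinates\<close>

abbreviation D :: real where "D \<equiv> \<bar>det b\<bar>"

definition T :: "nat \<Rightarrow> real ^ 'n ^ 'n" where "T j = matrix_inv (a j) ** b"

text \<open>A Riemann sum of \<open>F\<close> over the lattice of mesh \<open>T j\<close> with
  offset \<open>t\<close>; its mean over \<open>t\<close> in the unit cube is exactly the integral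
  of \<open>F\<close>.\<close>

definition lattice_sum :: "nat \<Rightarrow> (real ^ 'n \<Rightarrow> ennreal) \<Rightarrow> real ^ 'n \<Rightarrow> ennreal" where
  "lattice_sum j F t = \<bar>det (T j)\<bar> * (\<integral>\<^sup>+m. F (T j *v (t + int_vec m)) \<partial>count_space UNIV)"

definition q :: "int ^ 'n \<Rightarrow> real ^ 'n \<Rightarrow> complex" where
  "q l y = \<psi> (b *v (y + int_vec l))"

text \<open>Up to the factor \<open>D\<close>, the p-th power mass of \<psi> on the cell b(C + l),
  where C is the unit cube. These are the summable weights of the interaction between samples
  \<open>l\<close> cells apart.\<close>

definition A :: "int ^ 'n \<Rightarrow> ennreal" where "A l = cube_integral (\<lambda>y. pabs p (q l y))"

lemma D_pos: "D > 0"
  using inv_b by (simp add: invertible_det_nz)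

lemma
  assumes "0 < j"
  shows a_T: "a j *v (T j *v y) = b *v y"
    and det_T: "\<bar>det (a j)\<bar> * \<bar>det (T j)\<bar> = D"
    and inv_T: "invertible (T j)"
proof -
  have "\<exists>C. a j ** C = mat 1 \<and> C ** a j = mat 1"
    using inv_a[OF assms] by (simp add: invertible_def)
  then have "a j ** matrix_inv (a j) = mat 1"
    unfolding matrix_inv_def by (rule someI2_ex) simp
  then have "a j ** T j = b"
    by (simp add: T_def matrix_mul_assoc)
  then show "a j *v (T j *v y) = b *v y" and d: "\<bar>det (a j)\<bar> * \<bar>det (T j)\<bar> = D"
    by (simp add: matrix_vector_mul_assoc, metis abs_mult det_mul)
  then show "invertible (T j)" using D_pos by (auto simp: invertible_det_nz)
qed

lemma eventually_T_small:
  assumes "0 < d"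
  shows "eventually (\<lambda>j. \<forall>v. norm v \<le> M \<longrightarrow> norm (T j *v v) \<le> d) sequentially"
proof -
  let ?B = "onorm (\<lambda>x. b *v x)" and ?o = "\<lambda>j. onorm (\<lambda>x. matrix_inv (a j) *v x)"
  have bl: "bounded_linear (\<lambda>x. C *v x)" for C :: "real ^ 'n ^ 'n"
    by (rule matrix_vector_mul_bounded_linear)
  have "(\<lambda>j. ?o j * (?B * max M 0)) \<longlonglongrightarrow> 0"
    using tendsto_mult_left_zero[OF lim_a] .
  then have "eventually (\<lambda>j. ?o j * (?B * max M 0) < d) sequentially"
    using assms by (rule order_tendstoD(2))
  then show ?thesis
  proof eventually_elim
    case (elim j)
    show ?case
    proof (intro allI impI)
      fix v :: "real ^ 'n" assume v: "norm v \<le> M"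
      have "norm (T j *v v) = norm (matrix_inv (a j) *v (b *v v))"
        by (simp add: T_def matrix_vector_mul_assoc)
      also have "\<dots> \<le> ?o j * norm (b *v v)" by (rule onorm[OF bl])
      also have "\<dots> \<le> ?o j * (?B * norm v)"
        by (intro mult_left_mono onorm[OF bl] onorm_pos_le[OF bl])
      also have "\<dots> \<le> ?o j * (?B * max M 0)"
        using v by (intro mult_left_mono onorm_pos_le[OF bl]) auto
      finally show "norm (T j *v v) \<le> d" using elim by linarith
    qed
  qed
qed

lemma q_measurable: "q l \<in> borel_measurable lebesgue"
  unfolding q_def[abs_def] by (rule measurable_matrix_add_lebesgue[OF inv_b \<psi>_measurable])

lemma pabs_q_measurable: "(\<lambda>y. pabs p (q l y)) \<in> borel_measurable (lebesgue_on unit_cube)"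
  by (rule measurable_cube[OF measurable_compose[OF q_measurable measurable_pabs]])

lemma A_summable: "(\<integral>\<^sup>+l. A l \<partial>count_space UNIV) < \<infinity>"
proof -
  have "(\<integral>\<^sup>+x. pabs p (\<psi> x) \<partial>lebesgue) = D * (\<integral>\<^sup>+l. A l \<partial>count_space UNIV)"
    unfolding A_def q_def by (rule nn_integral_unfold[OF inv_b pabs_\<psi>_measurable])
  moreover have "(\<integral>\<^sup>+x. pabs p (\<psi> x) \<partial>lebesgue) < \<infinity>" using \<psi> by (simp add: Lp_fun_iff)
  ultimately show ?thesis using D_pos by (auto simp: ennreal_mult_less_top)
qed

lemma A_less_top: "A l < top"
  using sum_le_nn_integral_count_space[of "{l}" UNIV A] A_summable by (simp add: le_less_trans)

lemma cube_integral_pabs_q: "cube_integral (\<lambda>y. \<integral>\<^sup>+l. pabs p (q l y) \<partial>count_space UNIV) = (\<integral>\<^sup>+l. A l \<partial>count_space UNIV)"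
  unfolding A_def by (rule nn_integral_count_space_nn_integral[OF countableI_type pabs_q_measurable])

lemma AE_q_summable: "AE y in lebesgue_on unit_cube. (\<integral>\<^sup>+l. pabs p (q l y) \<partial>count_space UNIV) < \<infinity>"
proof -
  have "AE y in lebesgue_on unit_cube. (\<integral>\<^sup>+l. pabs p (q l y) \<partial>count_space UNIV) \<noteq> \<infinity>"
    using A_summable cube_integral_pabs_q
    by (intro nn_integral_PInf_AE borel_measurable_nn_integral_count_space pabs_q_measurable) auto
  then show ?thesis by eventually_elim (simp add: less_top)
qed

lemma periodization_eq: "periodization b \<psi> (b *v y) = of_real D * (\<Sum>\<^sub>\<infinity>l. q l y)"
proof -
  have "(\<Sum>\<^sub>\<infinity>k. \<psi> (b *v y - b *v int_vec k)) = (\<Sum>\<^sub>\<infinity>l. \<psi> (b *v y - b *v int_vec (- l)))"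
    by (rule infsum_reindex_bij_betw[symmetric]) (rule bij_uminus)
  then show ?thesis
    by (simp add: periodization_def q_def int_vec_minus matrix_vector_right_distrib mult.commute[of b]
        vec.neg)
qed

text \<open>The defect of the scaled periodization from 1; the integral of its p-th power over the
  cube is \<sigma>.\<close>

definition h :: "complex \<Rightarrow> real ^ 'n \<Rightarrow> complex" where
  "h lam y = lam * periodization b \<psi> (b *v y) - 1"

lemma h_eq: "h lam y = lam * of_real D * (\<Sum>\<^sub>\<infinity>l. q l y) - 1"
  by (simp add: h_def periodization_eq)

lemma h_measurable: "h lam \<in> borel_measurable lebesgue"
  unfolding h_eq[abs_def]
  by (intro borel_measurable_diff borel_measurable_times borel_measurable_const
      borel_measurable_infsum countableI_type q_measurable)

text \<open>The number \<sigma> is given by a Bochner integral, whose value for a non-integrable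
  function is 0 by default. Membership ensures that it equals the nonnegative integral used in the
  estimates.\<close>

lemma h_Lp: "h lam \<in> Lp_fun (lebesgue_on unit_cube) p"
proof -
  let ?\<mu> = "lam * of_real D" and ?q = "\<lambda>y. \<integral>\<^sup>+l. pabs p (q l y) \<partial>count_space UNIV"
  have m: "?q \<in> borel_measurable (lebesgue_on unit_cube)"
    by (intro borel_measurable_nn_integral_count_space countableI_type pabs_q_measurable)
  have "pabs p (h lam y) \<le> pabs p ?\<mu> * ?q y + 1" for y
  proof -
    have "pabs p (h lam y) \<le> pabs p (?\<mu> * (\<Sum>\<^sub>\<infinity>l. q l y)) + pabs p 1"
      unfolding h_eq by (rule pabs_diff_le[OF p])
    also have "\<dots> \<le> pabs p ?\<mu> * ?q y + 1"
      unfolding pabs_mult[of p ?\<mu>] by (intro add_mono mult_left_mono pabs_infsum_le p) (simp_all add: pabs_def)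
    finally show ?thesis .
  qed
  then have "cube_integral (\<lambda>y. pabs p (h lam y)) \<le> cube_integral (\<lambda>y. pabs p ?\<mu> * ?q y + 1)"
    by (rule nn_integral_mono)
  also have "\<dots> = pabs p ?\<mu> * cube_integral ?q + cube_integral (\<lambda>y :: real ^ 'n. 1)"
    using m by (subst nn_integral_add) (simp_all add: nn_integral_cmult)
  also have "\<dots> < \<infinity>"
    unfolding cube_integral_pabs_q cube_integral_const using A_summable
    by (simp add: ennreal_mult_less_top)
  finally show ?thesis by (simp add: Lp_fun_iff measurable_cube h_measurable)
qed

section \<open>Sampled coefficients at one scale\<close>

text \<open>The power of the determinant cancels the normalization of the wavelet, and
  \<open>D\<close> is the factor in the periodization: a constant \<open>f\<close> would be
  multiplied by \<open>lam\<close> times the periodization at a_j x.\<close>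

definition coeff :: "complex \<Rightarrow> (real ^ 'n \<Rightarrow> complex) \<Rightarrow> nat \<Rightarrow> real ^ 'n \<Rightarrow> nat \<times> (int ^ 'n) \<Rightarrow> complex" where
  "coeff lam f j t = (\<lambda>(j', k). if j' = j
     then lam * of_real (D * \<bar>det (a j)\<bar> powr (- 1 / p)) * f (T j *v (t + int_vec k)) else 0)"

lemma scales_row: "0 < j \<Longrightarrow> Pair j ` UNIV \<subseteq> scales"
  by (auto simp: scales_def)

text \<open>At x = T(y + m) the wavelet with index k = m - l takes its argument at a_j x - b k = b(y
  + l), which does not involve \<open>m\<close>. Reindexing by \<open>l\<close> thus separates the
  samples of \<open>f\<close>, which carry \<open>m\<close>, from \<open>q l y\<close>, which
  carries the position in the cell.\<close>

lemma synth_coeff: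
  assumes j: "0 < j"
  shows "synth (coeff lam f j t) (T j *v (y + int_vec m)) =
    lam * of_real D * (\<Sum>\<^sub>\<infinity>l. f (T j *v (t + int_vec (m - l))) * q l y)"
proof -
  let ?x = "T j *v (y + int_vec m)"
  let ?g = "\<lambda>i. coeff lam f j t i * W i ?x"
  let ?d = "\<bar>det (a j)\<bar>"
  have d: "?d > 0" using inv_a[OF j] by (simp add: invertible_det_nz)
  have "synth (coeff lam f j t) ?x = infsum ?g (Pair j ` UNIV)"
    unfolding synth_def using scales_row[OF j]
    by (intro infsum_cong_neutral) (auto simp: coeff_def scales_def split: if_splits)
  also have "\<dots> = (\<Sum>\<^sub>\<infinity>k. ?g (j, k))"
    by (subst infsum_reindex) (auto simp: inj_on_def o_def)
  also have "\<dots> = (\<Sum>\<^sub>\<infinity>l. ?g (j, m - l))"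
    by (rule infsum_reindex_bij_betw[symmetric]) (rule bij_betw_byWitness[where f'="\<lambda>k. m - k"], auto)
  also have "\<dots> = (\<Sum>\<^sub>\<infinity>l. (lam * of_real D) * (f (T j *v (t + int_vec (m - l))) * q l y))"
  proof (rule infsum_cong)
    fix l
    have "a j *v ?x - b *v int_vec (m - l) = b *v (y + int_vec l)"
      unfolding a_T[OF j] int_vec_diff by (simp flip: matrix_vector_mult_diff_distrib)
    then have "?g (j, m - l) = (of_real (?d powr (- 1 / p)) * of_real (?d powr (1 / p))) *
        ((lam * of_real D) * (f (T j *v (t + int_vec (m - l))) * q l y))"
      by (simp add: coeff_def wavelet_def q_def)
    also have "complex_of_real (?d powr (- 1 / p)) * of_real (?d powr (1 / p)) = 1"
      using d by (simp flip: of_real_mult powr_add)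
    finally show "?g (j, m - l) = (lam * of_real D) * (f (T j *v (t + int_vec (m - l))) * q l y)"
      by simp
  qed
  also have "\<dots> = lam * of_real D * (\<Sum>\<^sub>\<infinity>l. f (T j *v (t + int_vec (m - l))) * q l y)"
    by (rule infsum_cmult_right')
  finally show ?thesis .
qed

text \<open>Because \<bar>det a_j\<bar> \<bar>det T_j\<bar> = D, the p-th power of D \<bar>det
  a_j\<bar>^(-1/p) is D^(p-1) \<bar>det T_j\<bar>; its last factor is the one in the lattice
  sum.\<close>

lemma nn_integral_coeff:
  assumes j: "0 < j"
  shows "(\<integral>\<^sup>+i. pabs p (coeff lam f j t i) \<partial>count_space scales) =
    pabs p lam * ennreal (D powr (p - 1)) * lattice_sum j (\<lambda>x. pabs p (f x)) t"
proof -
  let ?d = "\<bar>det (a j)\<bar>"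
  have d: "?d > 0" using inv_a[OF j] by (simp add: invertible_det_nz)
  have e: "pabs p (of_real (D * ?d powr (- 1 / p))) = ennreal (D powr (p - 1)) * ennreal \<bar>det (T j)\<bar>"
  proof -
    have "(D * ?d powr (- 1 / p)) powr p = D powr p / ?d"
      using d p by (simp add: powr_mult powr_powr powr_minus_divide powr_divide)
    also have "\<dots> = D powr (p - 1) * \<bar>det (T j)\<bar>"
      using d D_pos by (simp add: powr_diff det_T[OF j, symmetric])
    finally show ?thesis
      using D_pos by (simp only: pabs_def norm_of_real abs_mult abs_of_nonneg powr_ge_zero abs_abs) (simp add: ennreal_mult)
  qed
  have "(\<integral>\<^sup>+i. pabs p (coeff lam f j t i) \<partial>count_space scales) =
      (\<integral>\<^sup>+i. pabs p (coeff lam f j t i) \<partial>count_space (Pair j ` UNIV))"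
    using scales_row[OF j] by (intro nn_integral_count_space_eq) (auto simp: coeff_def split: if_splits)
  also have "\<dots> = (\<integral>\<^sup>+k. pabs p (coeff lam f j t (j, k)) \<partial>count_space UNIV)"
    by (rule nn_integral_bij_count_space[symmetric]) (auto simp: bij_betw_def inj_on_def)
  also have "\<dots> = (\<integral>\<^sup>+k. (pabs p lam * pabs p (of_real (D * ?d powr (- 1 / p)))) *
      pabs p (f (T j *v (t + int_vec k))) \<partial>count_space UNIV)"
    by (simp only: coeff_def prod.case if_True refl pabs_mult simp_thms)
  also have "\<dots> = pabs p lam * pabs p (of_real (D * ?d powr (- 1 / p))) *
      (\<integral>\<^sup>+k. pabs p (f (T j *v (t + int_vec k))) \<partial>count_space UNIV)"
    by (rule nn_integral_cmult) simp
  finally show ?thesis unfolding e lattice_sum_def by (simp only: mult.assoc)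
qed

lemma lattice_sum_measurable:
  "0 < j \<Longrightarrow> F \<in> borel_measurable lebesgue \<Longrightarrow> lattice_sum j F \<in> borel_measurable (lebesgue_on unit_cube)"
  unfolding lattice_sum_def[abs_def] by (intro measurable_cube measurable_unfold inv_T)

lemma cube_integral_lattice_sum:
  "0 < j \<Longrightarrow> F \<in> borel_measurable lebesgue \<Longrightarrow> cube_integral (lattice_sum j F) = (\<integral>\<^sup>+x. F x \<partial>lebesgue)"
  unfolding lattice_sum_def[abs_def] by (rule cube_integral_unfold[OF inv_T])

section \<open>Differences between samples in different cells\<close>

definition shift_diff :: "(real ^ 'n \<Rightarrow> complex) \<Rightarrow> nat \<Rightarrow> int ^ 'n \<Rightarrow> real ^ 'n \<Rightarrow> ennreal" where
  "shift_diff f j l x = pabs p (f x - f (x - T j *v int_vec l))"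


lemma
  assumes j: "0 < j" and f: "f \<in> Lp_fun lebesgue p"
  shows shift_diff_measurable: "shift_diff f j l \<in> borel_measurable lebesgue"
    and nn_integral_shift_diff_le: "(\<integral>\<^sup>+x. shift_diff f j l x \<partial>lebesgue) \<le>
      (\<integral>\<^sup>+x. pabs p (f x) \<partial>lebesgue) + (\<integral>\<^sup>+x. pabs p (f x) \<partial>lebesgue)"
proof -
  let ?s = "- (T j *v int_vec l)"
  have fm: "f \<in> borel_measurable lebesgue" using f by (simp add: Lp_fun_iff)
  have fs: "(\<lambda>x. f (x + ?s)) \<in> borel_measurable lebesgue"
    by (rule measurable_compose[OF measurable_add_lebesgue fm])
  note mp = measurable_compose[OF _ measurable_pabs]
  have eq: "shift_diff f j l = (\<lambda>x. pabs p (f x - f (x + ?s)))"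
    by (simp add: shift_diff_def fun_eq_iff)
  show "shift_diff f j l \<in> borel_measurable lebesgue"
    unfolding eq by (rule mp[OF borel_measurable_diff[OF fm fs]])
  have "(\<integral>\<^sup>+x. shift_diff f j l x \<partial>lebesgue) \<le>
      (\<integral>\<^sup>+x. pabs p (f x) + pabs p (f (x + ?s)) \<partial>lebesgue)"
    unfolding eq by (intro nn_integral_mono pabs_diff_le p)
  also have "\<dots> = (\<integral>\<^sup>+x. pabs p (f x) \<partial>lebesgue) + (\<integral>\<^sup>+x. pabs p (f (x + ?s)) \<partial>lebesgue)"
    by (rule nn_integral_add[OF mp[OF fm] mp[OF fs]])
  also have "(\<integral>\<^sup>+x. pabs p (f (x + ?s)) \<partial>lebesgue) = (\<integral>\<^sup>+x. pabs p (f x) \<partial>lebesgue)"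
    by (rule nn_integral_add_lebesgue[OF mp[OF fm]])
  finally show "(\<integral>\<^sup>+x. shift_diff f j l x \<partial>lebesgue) \<le>
      (\<integral>\<^sup>+x. pabs p (f x) \<partial>lebesgue) + (\<integral>\<^sup>+x. pabs p (f x) \<partial>lebesgue)" .
qed

text \<open>For fixed \<open>l\<close> the translation vector \<open>T j *v int_vec l\<close> tends
  to 0. Once it is shorter than \<open>d\<close>, the integrand is bounded by the oscillation
  majorant plus its translate, two functions of equal small integral.\<close>

lemma shift_diff_tendsto:
  assumes f: "f \<in> Lp_fun lebesgue p"
  shows "(\<lambda>j. \<integral>\<^sup>+x. shift_diff f j l x \<partial>lebesgue) \<longlonglongrightarrow> 0"
proof (rule order_tendstoI)
  fix \<epsilon> :: ennreal assume "0 < \<epsilon>"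
  then obtain z where z: "0 < z" "z < \<epsilon>" using dense by blast
  obtain r where r: "0 < r" "ennreal r < \<epsilon>"
    using z by (cases z) auto
  obtain d \<phi> where d: "d > 0" "\<phi> \<in> borel_measurable lebesgue" "(\<integral>\<^sup>+x. \<phi> x \<partial>lebesgue) \<le> ennreal (r / 2)"
    "\<And>u v. dist u v \<le> d \<Longrightarrow> pabs p (f u - f v) \<le> \<phi> u + \<phi> v"
    using small_osc_Lp[OF p f] r(1) unfolding small_osc_def by (meson half_gt_zero)
  have "eventually (\<lambda>j. \<forall>v. norm v \<le> norm (int_vec l :: real ^ 'n) \<longrightarrow> norm (T j *v v) \<le> d) sequentially"
    by (rule eventually_T_small[OF d(1)])
  then show "eventually (\<lambda>j. (\<integral>\<^sup>+x. shift_diff f j l x \<partial>lebesgue) < \<epsilon>) sequentially"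
  proof eventually_elim
    case (elim j)
    let ?s = "- (T j *v int_vec l)"
    have "(\<integral>\<^sup>+x. shift_diff f j l x \<partial>lebesgue) \<le> (\<integral>\<^sup>+x. \<phi> x + \<phi> (x + ?s) \<partial>lebesgue)"
    proof (rule nn_integral_mono)
      fix x
      have "dist x (x + ?s) \<le> d" using elim by (simp add: dist_norm)
      from d(4)[OF this] show "shift_diff f j l x \<le> \<phi> x + \<phi> (x + ?s)"
        by (simp add: shift_diff_def)
    qed
    also have "\<dots> = (\<integral>\<^sup>+x. \<phi> x \<partial>lebesgue) + (\<integral>\<^sup>+x. \<phi> (x + ?s) \<partial>lebesgue)"
      by (rule nn_integral_add[OF d(2) measurable_compose[OF measurable_add_lebesgue d(2)]])
    also have "\<dots> = (\<integral>\<^sup>+x. \<phi> x \<partial>lebesgue) + (\<integral>\<^sup>+x. \<phi> x \<partial>lebesgue)"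
      by (simp only: nn_integral_add_lebesgue[OF d(2)])
    also have "\<dots> \<le> ennreal (r / 2) + ennreal (r / 2)" by (intro add_mono d(3))
    also have "\<dots> = ennreal r" using r(1) by (simp flip: ennreal_plus)
    finally show ?case using r(2) by (rule le_less_trans)
  qed
qed simp

definition mean_shift_diff :: "(real ^ 'n \<Rightarrow> complex) \<Rightarrow> nat \<Rightarrow> ennreal" where
  "mean_shift_diff f j = (\<integral>\<^sup>+l. A l * (\<integral>\<^sup>+x. shift_diff f j l x \<partial>lebesgue) \<partial>count_space UNIV)"

text \<open>The convergence is not uniform in \<open>l\<close>; distant cells are controlled by the
  summable weights \<open>A l\<close> through dominated convergence, with twice the p-th power of
  the norm as the uniform bound. \<open>Suc j\<close> occurs because 0 is not a scale and the
  uniform bound is proved for positive \<open>j\<close>.\<close>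

lemma mean_shift_diff_tendsto:
  assumes f: "f \<in> Lp_fun lebesgue p"
  shows "(\<lambda>j. mean_shift_diff f (Suc j)) \<longlonglongrightarrow> 0"
proof -
  let ?N = "(\<integral>\<^sup>+x. pabs p (f x) \<partial>lebesgue)"
  have N: "?N < \<infinity>" using f by (simp add: Lp_fun_iff)
  have "(\<lambda>j. mean_shift_diff f (Suc j)) \<longlonglongrightarrow> (\<integral>\<^sup>+(l :: int ^ 'n). 0 \<partial>count_space UNIV)"
    unfolding mean_shift_diff_def
  proof (rule nn_integral_dominated_convergence[where w="\<lambda>l. A l * (?N + ?N)"])
    show "AE l in count_space UNIV. A l * (\<integral>\<^sup>+x. shift_diff f (Suc j) l x \<partial>lebesgue) \<le> A l * (?N + ?N)" for j
      by (intro AE_I2 mult_left_mono nn_integral_shift_diff_le f) auto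
    have "(\<integral>\<^sup>+l. A l * (?N + ?N) \<partial>count_space UNIV) = (\<integral>\<^sup>+l. A l \<partial>count_space UNIV) * (?N + ?N)"
      by (rule nn_integral_multc) simp
    also have "\<dots> < \<infinity>" using A_summable N by (simp add: ennreal_mult_less_top)
    finally show "(\<integral>\<^sup>+l. A l * (?N + ?N) \<partial>count_space UNIV) < \<infinity>" .
    show "AE l in count_space UNIV. (\<lambda>j. A l * (\<integral>\<^sup>+x. shift_diff f (Suc j) l x \<partial>lebesgue)) \<longlonglongrightarrow> 0"
    proof (rule AE_I2)
      fix l
      have "(\<lambda>j. A l * (\<integral>\<^sup>+x. shift_diff f (Suc j) l x \<partial>lebesgue)) \<longlonglongrightarrow> A l * 0"
        using A_less_top[of l] by (intro ennreal_tendsto_cmult LIMSEQ_Suc shift_diff_tendsto f)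
      then show "(\<lambda>j. A l * (\<integral>\<^sup>+x. shift_diff f (Suc j) l x \<partial>lebesgue)) \<longlonglongrightarrow> 0" by simp
    qed
  qed simp_all
  then show ?thesis by simp
qed

text \<open>\<open>pabs_reconstruction_error\<close> is applied at each point of each cell T(C + m),
  where C is the unit cube, with the sample at T(t + m) as the nearby value. This sample is constant
  on the cell, so integration over \<open>y\<close> splits off the mass of \<open>h lam\<close> and
  the weights \<open>A l\<close>. Summing over \<open>m\<close> turns the remaining sample values
  into lattice sums at offset \<open>t\<close>.\<close>

lemma reconstruction_estimate:
  assumes j: "0 < j" and f: "f \<in> borel_measurable lebesgue" and t: "t \<in> unit_cube"
    and \<phi>: "\<phi> \<in> borel_measurable lebesgue"
      "\<And>u v. dist u v \<le> d \<Longrightarrow> pabs p (f u - f v) \<le> \<phi> u + \<phi> v"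
    and small: "\<And>y. y \<in> unit_cube \<Longrightarrow> norm (T j *v (y - t)) \<le> d"
  shows "(\<integral>\<^sup>+x. pabs p (f x - synth (coeff lam f j t) x) \<partial>lebesgue) \<le>
    (\<integral>\<^sup>+x. \<phi> x \<partial>lebesgue) + lattice_sum j \<phi> t +
    cube_integral (\<lambda>y. pabs p (h lam y)) * lattice_sum j (\<lambda>x. pabs p (f x)) t +
    pabs p (lam * of_real D) * (\<integral>\<^sup>+l. A l * lattice_sum j (shift_diff f j l) t \<partial>count_space UNIV)"
proof -
  let ?S = "synth (coeff lam f j t)" and ?\<mu> = "lam * of_real D"
  let ?P = "\<lambda>y m. T j *v (y + int_vec m)"
  let ?H = "cube_integral (\<lambda>y. pabs p (h lam y))"
  let ?sd = "\<lambda>m l. shift_diff f j l (?P t m)"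
  let ?Z = "\<lambda>m. \<integral>\<^sup>+l. ?sd m l * A l \<partial>count_space UNIV"
  note mp = measurable_compose[OF _ measurable_pabs]
  note T = inv_T[OF j]
  have mphi: "(\<lambda>y. \<phi> (?P y m)) \<in> borel_measurable (lebesgue_on unit_cube)" for m
    by (rule measurable_cube[OF measurable_matrix_add_lebesgue[OF T \<phi>(1)]])
  have mh: "(\<lambda>y. pabs p (h lam y)) \<in> borel_measurable (lebesgue_on unit_cube)"
    by (rule measurable_cube[OF mp[OF h_measurable]])
  have mq: "(\<lambda>y. ?sd m l * pabs p (q l y)) \<in> borel_measurable (lebesgue_on unit_cube)" for m l
    by (intro borel_measurable_times_ennreal borel_measurable_const pabs_q_measurable)
  have mZ: "(\<lambda>y. \<integral>\<^sup>+l. ?sd m l * pabs p (q l y) \<partial>count_space UNIV) \<in> borel_measurable (lebesgue_on unit_cube)" for m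
    by (rule borel_measurable_nn_integral_count_space[OF countableI_type mq])
  have pointwise: "cube_integral (\<lambda>y. pabs p (f (?P y m) - ?S (?P y m))) \<le>
      cube_integral (\<lambda>y. \<phi> (?P y m)) + \<phi> (?P t m) + pabs p (f (?P t m)) * ?H + pabs p ?\<mu> * ?Z m" for m
  proof -
    have "cube_integral (\<lambda>y. pabs p (f (?P y m) - ?S (?P y m))) \<le>
        cube_integral (\<lambda>y. (\<phi> (?P y m) + \<phi> (?P t m)) + pabs p (f (?P t m)) * pabs p (h lam y) +
          pabs p ?\<mu> * (\<integral>\<^sup>+l. ?sd m l * pabs p (q l y) \<partial>count_space UNIV))"
    proof (rule nn_integral_mono_AE)
      show "AE y in lebesgue_on unit_cube. pabs p (f (?P y m) - ?S (?P y m)) \<le>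
          (\<phi> (?P y m) + \<phi> (?P t m)) + pabs p (f (?P t m)) * pabs p (h lam y) +
          pabs p ?\<mu> * (\<integral>\<^sup>+l. ?sd m l * pabs p (q l y) \<partial>count_space UNIV)"
        \<comment> \<open>The pointwise estimate requires p-summability of \<open>q l y\<close> over
          \<open>l\<close>, which holds for almost every \<open>y\<close>; \<open>AE_space\<close>
          supplies that \<open>y\<close> is in the cube, where the smallness assumption
          applies.\<close>
        using AE_q_summable AE_space
      proof eventually_elim
        case (elim y)
        then have y: "y \<in> unit_cube" by (simp add: space_restrict_space)
        have "dist (?P y m) (?P t m) \<le> d"
          using small[OF y] by (simp add: dist_norm flip: matrix_vector_mult_diff_distrib)
        from \<phi>(2)[OF this] have osc: "pabs p (f (?P y m) - f (?P t m)) \<le> \<phi> (?P y m) + \<phi> (?P t m)" .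
        have sd: "pabs p (f (?P t m) - f (?P t (m - l))) = ?sd m l" for l
        proof -
          have "?P t (m - l) = ?P t m - T j *v int_vec l"
            unfolding int_vec_diff by (simp add: matrix_vector_right_distrib matrix_vector_mult_diff_distrib)
          then show ?thesis by (simp add: shift_diff_def)
        qed
        have "pabs p (f (?P y m) - ?S (?P y m)) \<le>
          pabs p (f (?P y m) - f (?P t m)) + pabs p (f (?P t m)) * pabs p (h lam y) +
          pabs p ?\<mu> * (\<integral>\<^sup>+l. ?sd m l * pabs p (q l y) \<partial>count_space UNIV)"
          unfolding synth_coeff[OF j] h_eq sd[symmetric]
          by (rule pabs_reconstruction_error[OF p elim(1)])
        also have "\<dots> \<le> (\<phi> (?P y m) + \<phi> (?P t m)) + pabs p (f (?P t m)) * pabs p (h lam y) +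
          pabs p ?\<mu> * (\<integral>\<^sup>+l. ?sd m l * pabs p (q l y) \<partial>count_space UNIV)"
          by (intro add_right_mono osc)
        finally show ?case .
      qed
    qed
    also have "\<dots> = cube_integral (\<lambda>y. \<phi> (?P y m)) + \<phi> (?P t m) + pabs p (f (?P t m)) * ?H +
        pabs p ?\<mu> * cube_integral (\<lambda>y. \<integral>\<^sup>+l. ?sd m l * pabs p (q l y) \<partial>count_space UNIV)"
      by (simp only: nn_integral_add nn_integral_cmult mphi mh mZ borel_measurable_const
          borel_measurable_add borel_measurable_times_ennreal cube_integral_const)
    also have "cube_integral (\<lambda>y. \<integral>\<^sup>+l. ?sd m l * pabs p (q l y) \<partial>count_space UNIV) = ?Z m"
      unfolding nn_integral_count_space_nn_integral[OF countableI_type mq] A_def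
      by (intro nn_integral_cong nn_integral_cmult pabs_q_measurable)
    finally show ?thesis .
  qed
  have mS: "(\<lambda>x. pabs p (f x - ?S x)) \<in> borel_measurable lebesgue"
    by (rule mp[OF borel_measurable_diff[OF f synth_measurable]])
  have "(\<integral>\<^sup>+x. pabs p (f x - ?S x) \<partial>lebesgue) =
      \<bar>det (T j)\<bar> * (\<integral>\<^sup>+m. cube_integral (\<lambda>y. pabs p (f (?P y m) - ?S (?P y m))) \<partial>count_space UNIV)"
    by (rule nn_integral_unfold[OF T mS])
  also have "\<dots> \<le> \<bar>det (T j)\<bar> * (\<integral>\<^sup>+m. (cube_integral (\<lambda>y. \<phi> (?P y m)) + \<phi> (?P t m) +
      pabs p (f (?P t m)) * ?H + pabs p ?\<mu> * ?Z m) \<partial>count_space UNIV)"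
    by (intro mult_left_mono nn_integral_mono pointwise) auto
  also have "\<dots> = \<bar>det (T j)\<bar> * (\<integral>\<^sup>+m. cube_integral (\<lambda>y. \<phi> (?P y m)) \<partial>count_space UNIV) +
      lattice_sum j \<phi> t + ?H * lattice_sum j (\<lambda>x. pabs p (f x)) t +
      pabs p ?\<mu> * (\<bar>det (T j)\<bar> * (\<integral>\<^sup>+m. ?Z m \<partial>count_space UNIV))"
    unfolding lattice_sum_def
    by (simp add: nn_integral_add nn_integral_cmult nn_integral_multc distrib_left ac_simps)
  also have "\<bar>det (T j)\<bar> * (\<integral>\<^sup>+m. cube_integral (\<lambda>y. \<phi> (?P y m)) \<partial>count_space UNIV) = (\<integral>\<^sup>+x. \<phi> x \<partial>lebesgue)"
    by (rule nn_integral_unfold[OF T \<phi>(1), symmetric])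
  \<comment> \<open>Exchanging the sums over cells \<open>m\<close> and displacements
    \<open>l\<close> produces one lattice sum for each \<open>l\<close>.\<close>
  also have "\<bar>det (T j)\<bar> * (\<integral>\<^sup>+m. ?Z m \<partial>count_space UNIV) =
      (\<integral>\<^sup>+l. A l * lattice_sum j (shift_diff f j l) t \<partial>count_space UNIV)"
  proof -
    have "(\<integral>\<^sup>+m. ?Z m \<partial>count_space UNIV) = (\<integral>\<^sup>+l. \<integral>\<^sup>+m. ?sd m l * A l \<partial>count_space UNIV \<partial>count_space UNIV)"
      by (rule nn_integral_count_space_nn_integral) auto
    then show ?thesis
      unfolding lattice_sum_def
      by (simp add: nn_integral_multc ac_simps flip: nn_integral_cmult)
  qed
  finally show ?thesis .
qed

lemma bounded_unit_cube: "bounded (unit_cube :: (real ^ 'n) set)"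
  by (rule bounded_subset[of "cbox 0 1"]) (auto simp: unit_cube_def mem_box_cart less_imp_le)


lemma Lp_fun_diff:
  assumes "f \<in> Lp_fun M p" "g \<in> Lp_fun M p"
  shows "(\<lambda>x. f x - g x) \<in> Lp_fun M p"
  using Lp_diff_integrable[OF p assms] assms by (auto simp: Lp_fun_def)

text \<open>The cube has measure 1, so the integral is a mean and cannot be smaller than a lower
  bound valid at every point.\<close>

lemma cube_integral_witness:
  assumes "cube_integral (G :: real ^ 'n \<Rightarrow> ennreal) < c"
  shows "\<exists>t\<in>unit_cube. G t < c"
proof (rule ccontr)
  assume "\<not> (\<exists>t\<in>unit_cube. G t < c)"
  then have ge: "c \<le> G t" if "t \<in> unit_cube" for t using that not_less by blast
  have "cube_integral (\<lambda>t :: real ^ 'n. c) \<le> cube_integral G"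
  proof (rule nn_integral_mono)
    fix t :: "real ^ 'n" assume "t \<in> space (lebesgue_on unit_cube)"
    then show "c \<le> G t" by (intro ge) (simp add: space_restrict_space)
  qed
  with assms show False unfolding cube_integral_const by simp
qed

text \<open>\<open>Y\<close> stands for \<open>\<parallel>c\<parallel>\<^sup>p\<close> divided by the constant \<open>\<bar>lam\<bar>\<^sup>p \<bar>det b\<bar>\<^sup>p\<^sup>-\<^sup>1\<close>. The last term on the left
  is the gain that makes the residuals tend to \<open>0\<close>.\<close>

lemma approximation_step:
  assumes f: "f \<in> Lp_fun lebesgue p"
    and \<sigma>: "cube_integral (\<lambda>y. pabs p (h lam y)) = ennreal \<sigma>" "0 \<le> \<sigma>" "\<sigma> < \<sigma>'" "\<sigma>' < 1"
  shows "\<exists>c\<in>ell scales p. \<exists>Y. (\<integral>\<^sup>+i. pabs p (c i) \<partial>count_space scales) \<le> pabs p lam * ennreal (D powr (p - 1)) * Y \<and>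
    ennreal (1 - \<sigma>') * Y + (\<integral>\<^sup>+x. pabs p (f x - synth c x) \<partial>lebesgue) +
    ennreal ((\<sigma>' - \<sigma>) / 2) * (\<integral>\<^sup>+x. pabs p (f x) \<partial>lebesgue) \<le> (\<integral>\<^sup>+x. pabs p (f x) \<partial>lebesgue)"
proof -
  let ?N = "\<integral>\<^sup>+x. pabs p (f x) \<partial>lebesgue"
  have fm: "f \<in> borel_measurable lebesgue" and "?N < \<infinity>" using f by (auto simp: Lp_fun_iff)
  then obtain n where n: "0 \<le> n" "?N = ennreal n" by (cases "?N") auto
  show ?thesis
  \<comment> \<open>The averaging argument needs the strict inequality G t < (1 - \<delta>) n, which
    is impossible for n = 0; there the zero sequence works.\<close>
  proof (cases "n = 0")
    case True
    have "synth (\<lambda>i. 0) x = 0" for x by (simp add: synth_def)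
    then show ?thesis
      by (intro bexI[of _ "\<lambda>i. 0"] exI[of _ 0]) (simp_all add: ell_iff n(2) True)
  next
    case False
    \<comment> \<open>Half of the gap between \<sigma> and \<sigma>'. The mean of the main terms is
      (1 - 2 \<delta>) n, so a distance \<eta> = \<delta> n remains below the target (1 - \<delta>)
      n. The majorant enters twice with \<eta>/8 and the shift term once with \<eta>/4, so the
      errors use only \<eta>/2 of it.\<close>
    define \<delta> where "\<delta> = (\<sigma>' - \<sigma>) / 2"
    have \<delta>: "0 < \<delta>" "\<delta> < 1" using \<sigma> by (simp_all add: \<delta>_def)
    define \<eta> where "\<eta> = \<delta> * n"
    have \<eta>: "0 < \<eta>" using \<delta> n False by (simp add: \<eta>_def)
    obtain d \<phi> where d: "d > 0" and \<phi>: "\<phi> \<in> borel_measurable lebesgue" "(\<integral>\<^sup>+x. \<phi> x \<partial>lebesgue) \<le> ennreal (\<eta> / 8)"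
      "\<And>u v. dist u v \<le> d \<Longrightarrow> pabs p (f u - f v) \<le> \<phi> u + \<phi> v"
      using small_osc_Lp[OF p f, unfolded small_osc_def, rule_format, of "\<eta> / 8"] \<eta> by auto
    obtain B where B: "\<And>y :: real ^ 'n. y \<in> unit_cube \<Longrightarrow> norm y \<le> B"
      using bounded_unit_cube by (auto simp: bounded_iff)
    let ?\<mu> = "lam * of_real D"
    \<comment> \<open>Two points of the cube differ by at most 2 B. Working with
      \<open>Suc j\<close> guarantees a positive scale.\<close>
    have "eventually (\<lambda>j. \<forall>v. norm v \<le> 2 * B \<longrightarrow> norm (T (Suc j) *v v) \<le> d) sequentially"
      using eventually_T_small[OF d, of "2 * B"] eventually_sequentially_Suc[of "\<lambda>j. \<forall>v. norm v \<le> 2 * B \<longrightarrow> norm (T j *v v) \<le> d"]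
      by simp
    moreover have "(\<lambda>j. pabs p ?\<mu> * mean_shift_diff f (Suc j)) \<longlonglongrightarrow> pabs p ?\<mu> * 0"
      by (intro ennreal_tendsto_cmult mean_shift_diff_tendsto f) simp
    then have "eventually (\<lambda>j. pabs p ?\<mu> * mean_shift_diff f (Suc j) < ennreal (\<eta> / 4)) sequentially"
      using \<eta> by (intro order_tendstoD(2)) auto
    ultimately have "eventually (\<lambda>j. (\<forall>v. norm v \<le> 2 * B \<longrightarrow> norm (T (Suc j) *v v) \<le> d) \<and>
        pabs p ?\<mu> * mean_shift_diff f (Suc j) < ennreal (\<eta> / 4)) sequentially"
      by (rule eventually_conj)
    then obtain j' where j': "\<forall>v. norm v \<le> 2 * B \<longrightarrow> norm (T (Suc j') *v v) \<le> d"
        "pabs p ?\<mu> * mean_shift_diff f (Suc j') < ennreal (\<eta> / 4)"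
      unfolding eventually_sequentially by blast
    define j where "j = Suc j'"
    have j: "0 < j" and Tj: "\<And>v. norm v \<le> 2 * B \<Longrightarrow> norm (T j *v v) \<le> d"
      and ej: "pabs p ?\<mu> * mean_shift_diff f j < ennreal (\<eta> / 4)"
      using j' by (auto simp: j_def)
    define Y where "Y = lattice_sum j (\<lambda>x. pabs p (f x))"
    define Z where "Z t = (\<integral>\<^sup>+l. A l * lattice_sum j (shift_diff f j l) t \<partial>count_space UNIV)" for t
    \<comment> \<open>The first summand is the weighted coefficient size, the bracket the bound of
      \<open>reconstruction_estimate\<close>. A point \<open>t\<close> where \<open>G\<close> is
      small controls both at once.\<close>
    define G where "G t = ennreal (1 - \<sigma>') * Y t + ((\<integral>\<^sup>+x. \<phi> x \<partial>lebesgue) + lattice_sum j \<phi> t +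
        ennreal \<sigma> * Y t + pabs p ?\<mu> * Z t)" for t
    note mf = measurable_compose[OF fm measurable_pabs, of p]
    note sd = shift_diff_measurable[OF j f]
    have mY: "Y \<in> borel_measurable (lebesgue_on unit_cube)"
      unfolding Y_def by (rule lattice_sum_measurable[OF j mf])
    have m\<phi>: "lattice_sum j \<phi> \<in> borel_measurable (lebesgue_on unit_cube)"
      by (rule lattice_sum_measurable[OF j \<phi>(1)])
    have msd: "(\<lambda>t. A l * lattice_sum j (shift_diff f j l) t) \<in> borel_measurable (lebesgue_on unit_cube)" for l
      by (intro borel_measurable_times_ennreal borel_measurable_const lattice_sum_measurable[OF j sd])
    have mZ: "Z \<in> borel_measurable (lebesgue_on unit_cube)"
      unfolding Z_def[abs_def] by (rule borel_measurable_nn_integral_count_space[OF countableI_type msd])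
    have IY: "cube_integral Y = ennreal n"
      unfolding Y_def n(2)[symmetric] by (rule cube_integral_lattice_sum[OF j mf])
    have IZ: "cube_integral Z = mean_shift_diff f j"
      unfolding Z_def mean_shift_diff_def nn_integral_count_space_nn_integral[OF countableI_type msd]
      by (intro nn_integral_cong) (simp add: nn_integral_cmult[OF lattice_sum_measurable[OF j sd]] cube_integral_lattice_sum[OF j sd])
    have "cube_integral G = ennreal (1 - \<sigma>') * ennreal n + ((\<integral>\<^sup>+x. \<phi> x \<partial>lebesgue) + (\<integral>\<^sup>+x. \<phi> x \<partial>lebesgue) +
        ennreal \<sigma> * ennreal n + pabs p ?\<mu> * mean_shift_diff f j)"
      unfolding G_def
      by (simp only: nn_integral_add nn_integral_cmult mY m\<phi> mZ borel_measurable_const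
          borel_measurable_add borel_measurable_times_ennreal cube_integral_const IY IZ
          cube_integral_lattice_sum[OF j \<phi>(1)])
    also have "\<dots> \<le> ennreal (1 - \<sigma>') * ennreal n + (ennreal (\<eta> / 8) + ennreal (\<eta> / 8) +
        ennreal \<sigma> * ennreal n + ennreal (\<eta> / 4))"
      using ej by (intro add_mono order_refl \<phi>(2)) auto
    also have "\<dots> = ennreal ((1 - \<sigma>') * n + (\<eta> / 8 + \<eta> / 8 + \<sigma> * n + \<eta> / 4))"
    proof -
      have nn: "0 \<le> 1 - \<sigma>'" "0 \<le> n" "0 \<le> \<sigma>" "0 \<le> (1 - \<sigma>') * n" "0 \<le> \<sigma> * n" "0 \<le> \<eta> / 8" "0 \<le> \<eta> / 4"
        using \<sigma> n(1) \<eta> by simp_all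
      show ?thesis
        by (simp only: ennreal_mult[symmetric] ennreal_plus[symmetric] add_nonneg_nonneg nn)
    qed
    also have "\<dots> < ennreal ((1 - \<delta>) * n)"
    proof (rule ennreal_lessI)
      have "(1 - \<sigma>') * n + (\<eta> / 8 + \<eta> / 8 + \<sigma> * n + \<eta> / 4) = (1 - \<delta>) * n - \<eta> / 2"
        by (simp add: \<eta>_def \<delta>_def field_simps)
      then show "(1 - \<sigma>') * n + (\<eta> / 8 + \<eta> / 8 + \<sigma> * n + \<eta> / 4) < (1 - \<delta>) * n" using \<eta> by simp
      show "0 < (1 - \<delta>) * n" using \<delta> n False by simp
    qed
    finally obtain t where t: "t \<in> unit_cube" "G t < ennreal ((1 - \<delta>) * n)"
      using cube_integral_witness by blast
    define c where "c = coeff lam f j t"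
    have c: "(\<integral>\<^sup>+i. pabs p (c i) \<partial>count_space scales) = pabs p lam * ennreal (D powr (p - 1)) * Y t"
      unfolding c_def Y_def by (rule nn_integral_coeff[OF j])
    \<comment> \<open>Smallness of \<open>G t\<close> also yields finiteness of \<open>Y t\<close>,
      since the weight 1 - \<sigma>' is positive; this puts the sampled coefficients into the
      sequence space.\<close>
    have "ennreal (1 - \<sigma>') * Y t \<le> G t" unfolding G_def by simp
    also have "G t < top" using t(2) by (rule less_trans) simp
    finally have "Y t < top" using \<sigma> by (auto simp: ennreal_mult_less_top)
    then have ell: "c \<in> ell scales p"
      using c j by (auto simp: ell_iff ennreal_mult_less_top c_def coeff_def scales_def)
    have "norm (T j *v (y - t)) \<le> d" if "y \<in> unit_cube" for y
      using norm_triangle_ineq4[of y t] B[OF that] B[OF t(1)] by (intro Tj) linarith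
    then have "(\<integral>\<^sup>+x. pabs p (f x - synth c x) \<partial>lebesgue) \<le>
      (\<integral>\<^sup>+x. \<phi> x \<partial>lebesgue) + lattice_sum j \<phi> t + ennreal \<sigma> * Y t + pabs p ?\<mu> * Z t"
      unfolding c_def Y_def Z_def \<sigma>(1)[symmetric]
      by (intro reconstruction_estimate[OF j fm t(1) \<phi>(1,3)]) auto
    then have "ennreal (1 - \<sigma>') * Y t + (\<integral>\<^sup>+x. pabs p (f x - synth c x) \<partial>lebesgue) \<le> G t"
      unfolding G_def by (rule add_left_mono)
    also have "G t \<le> ennreal ((1 - \<delta>) * n)" using t(2) by simp
    finally have "ennreal (1 - \<sigma>') * Y t + (\<integral>\<^sup>+x. pabs p (f x - synth c x) \<partial>lebesgue) + ennreal \<delta> * ennreal n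
        \<le> ennreal ((1 - \<delta>) * n) + ennreal \<delta> * ennreal n"
      by (rule add_right_mono)
    also have "\<dots> = ennreal n"
    proof -
      have "0 \<le> (1 - \<delta>) * n" "0 \<le> \<delta> * n" using \<delta> n(1) by simp_all
      then have "ennreal ((1 - \<delta>) * n) + ennreal (\<delta> * n) = ennreal ((1 - \<delta>) * n + \<delta> * n)"
        by (rule ennreal_plus[symmetric])
      also have "(1 - \<delta>) * n + \<delta> * n = n" by (simp add: left_diff_distrib)
      finally show ?thesis using \<delta> n(1) by (simp add: ennreal_mult)
    qed
    finally show ?thesis
      using ell c n(2) unfolding \<delta>_def by (intro bexI[of _ c] exI[of _ "Y t"]) auto
  qed
qed

end

section \<open>Iteration and the theorem\<close>

lemma nn_integral_count_space_Times:
  assumes "countable A" "countable B"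
  shows "(\<integral>\<^sup>+z. f z \<partial>count_space (A \<times> B)) = (\<integral>\<^sup>+x. \<integral>\<^sup>+y. f (x, y) \<partial>count_space B \<partial>count_space A)"
proof -
  interpret sigma_finite_measure "count_space B"
    by (rule sigma_finite_measure_count_space_countable[OF assms(2)])
  have eq: "count_space A \<Otimes>\<^sub>M count_space B = count_space (A \<times> B)"
    using assms by (rule pair_measure_countable)
  have "(\<integral>\<^sup>+x. \<integral>\<^sup>+y. f (x, y) \<partial>count_space B \<partial>count_space A) =
      (\<integral>\<^sup>+z. f z \<partial>(count_space A \<Otimes>\<^sub>M count_space B))"
    by (rule nn_integral_fst) (simp add: eq)
  then show ?thesis by (simp add: eq)
qed

lemma nn_integral_count_space_le:
  fixes g :: "nat \<Rightarrow> ennreal"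
  assumes "\<And>M. (\<Sum>n<M. g n) \<le> x"
  shows "(\<integral>\<^sup>+n. g n \<partial>count_space UNIV) \<le> x"
  unfolding nn_integral_count_space_nat using assms by (intro suminf_le_const) auto

section \<open>Summing the approximation steps to an exact solution\<close>

context affine_system
begin

lemma pabs_summable_tendsto_0:
  fixes z :: "nat \<Rightarrow> complex"
  assumes "(\<integral>\<^sup>+n. pabs p (z n) \<partial>count_space UNIV) < \<infinity>"
  shows "z \<longlonglongrightarrow> 0"
  by (rule summable_LIMSEQ_zero[OF summable_on_imp_summable[OF pabs_summable(2)[OF p assms]]])

text \<open>\<open>AE_superposition\<close> on the product index set gives absolute convergence of
  the double series at almost every point, so the sum over steps and the sum over wavelets may be
  exchanged there. The coefficientwise sums obey the p-th power bound by subadditivity.\<close>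

lemma synth_superposition:
  assumes C: "\<And>n :: nat. C n \<in> ell scales p"
    and fin: "(\<integral>\<^sup>+n. \<integral>\<^sup>+i. pabs p (C n i) \<partial>count_space scales \<partial>count_space UNIV) < \<infinity>"
  defines "c \<equiv> \<lambda>i. \<Sum>\<^sub>\<infinity>n. C n i"
  shows "c \<in> ell scales p"
    and "(\<integral>\<^sup>+i. pabs p (c i) \<partial>count_space scales) \<le>
      (\<integral>\<^sup>+n. \<integral>\<^sup>+i. pabs p (C n i) \<partial>count_space scales \<partial>count_space UNIV)"
    and "AE x in lebesgue. (\<lambda>M. \<Sum>n<M. synth (C n) x) \<longlonglongrightarrow> synth c x"
proof -
  have "(\<integral>\<^sup>+i. pabs p (c i) \<partial>count_space scales) \<le>
      (\<integral>\<^sup>+i. \<integral>\<^sup>+n. pabs p (C n i) \<partial>count_space UNIV \<partial>count_space scales)"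
    unfolding c_def by (intro nn_integral_mono pabs_infsum_le p)
  also have "\<dots> = (\<integral>\<^sup>+n. \<integral>\<^sup>+i. pabs p (C n i) \<partial>count_space scales \<partial>count_space UNIV)"
    by (rule nn_integral_count_space_nn_integral) auto
  finally show le: "(\<integral>\<^sup>+i. pabs p (c i) \<partial>count_space scales) \<le>
      (\<integral>\<^sup>+n. \<integral>\<^sup>+i. pabs p (C n i) \<partial>count_space scales \<partial>count_space UNIV)" .
  have "c i = 0" if "i \<notin> scales" for i
  proof -
    have "C n i = 0" for n using C[of n] that unfolding ell_iff by blast
    then show ?thesis by (simp add: c_def)
  qed
  then show "c \<in> ell scales p"
    using le_less_trans[OF le fin] by (simp add: ell_iff)
  have ctb: "countable (UNIV \<times> scales :: (nat \<times> nat \<times> (int ^ 'n)) set)"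
    by (rule countableI_type)
  have "AE x in lebesgue. (\<integral>\<^sup>+k. pabs p ((case k of (n, i) \<Rightarrow> C n i) * W (snd k) x) \<partial>count_space (UNIV \<times> scales)) < \<infinity>"
    using fin by (intro AE_superposition ctb)
      (auto simp: nn_integral_count_space_Times[OF countableI_type countable_scales])
  then show "AE x in lebesgue. (\<lambda>M. \<Sum>n<M. synth (C n) x) \<longlonglongrightarrow> synth c x"
  proof eventually_elim
    case (elim x)
    have sm: "(\<lambda>(n, i). C n i * W i x) summable_on UNIV \<times> scales"
      using pabs_summable(2)[OF p elim] by (simp add: case_prod_beta')
    have "(\<lambda>n. \<Sum>\<^sub>\<infinity>i\<in>scales. C n i * W i x) summable_on UNIV"
      using summable_on_Sigma_banach[OF sm] by simp
    then have "(\<lambda>n. synth (C n) x) sums (\<Sum>\<^sub>\<infinity>n. synth (C n) x)"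
      unfolding synth_def by (intro has_sum_imp_sums has_sum_infsum)
    also have "(\<Sum>\<^sub>\<infinity>n. synth (C n) x) = (\<Sum>\<^sub>\<infinity>i\<in>scales. \<Sum>\<^sub>\<infinity>n. C n i * W i x)"
      unfolding synth_def by (rule infsum_swap_banach[OF sm])
    also have "\<dots> = synth c x"
      unfolding synth_def c_def by (intro infsum_cong) (rule infsum_cmult_left')
    finally show ?case by (simp add: sums_def)
  qed
qed

text \<open>The step inequality telescopes along the residuals. Its first term bounds (1 -
  \<sigma>') times the sum of all \<open>Y (F n)\<close>, which gives the constant; its gain term
  bounds the sum of the p-th powers of the residual norms, which forces the residuals to 0 almost
  everywhere along the whole sequence.\<close>

lemma exact_reconstruction:
  assumes f: "f \<in> Lp_fun lebesgue p"
    and \<sigma>: "cube_integral (\<lambda>y. pabs p (h lam y)) = ennreal \<sigma>" "0 \<le> \<sigma>" "\<sigma> < \<sigma>'" "\<sigma>' < 1"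
  shows "\<exists>c\<in>ell scales p. (AE x in lebesgue. synth c x = f x) \<and>
    ennreal (1 - \<sigma>') * (\<integral>\<^sup>+i. pabs p (c i) \<partial>count_space scales) \<le>
    pabs p lam * ennreal (D powr (p - 1)) * (\<integral>\<^sup>+x. pabs p (f x) \<partial>lebesgue)"
proof -
  let ?N = "\<lambda>g. \<integral>\<^sup>+x. pabs p (g x) \<partial>lebesgue" and ?s = "\<lambda>c. \<integral>\<^sup>+i. pabs p (c i) \<partial>count_space scales"
  let ?K = "pabs p lam * ennreal (D powr (p - 1))" and ?\<tau> = "ennreal (1 - \<sigma>')" and ?\<delta> = "ennreal ((\<sigma>' - \<sigma>) / 2)"
  define P where "P g c Y \<longleftrightarrow> c \<in> ell scales p \<and> ?s c \<le> ?K * Y \<and>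
      ?\<tau> * Y + ?N (\<lambda>x. g x - synth c x) + ?\<delta> * ?N g \<le> ?N g" for g c Y
  \<comment> \<open>A step is chosen for every \<open>g\<close> in the space at once, so that the
    recursion defining \<open>F\<close> can apply it to each residual.\<close>
  have "\<exists>z. P g (fst z) (snd z)" if "g \<in> Lp_fun lebesgue p" for g
    using approximation_step[OF that \<sigma>] unfolding P_def by force
  then obtain z where "\<And>g. g \<in> Lp_fun lebesgue p \<Longrightarrow> P g (fst (z g)) (snd (z g))"
    by metis
  then obtain c Y where P: "\<And>g. g \<in> Lp_fun lebesgue p \<Longrightarrow> P g (c g) (Y g)"
    by (rule that[of "\<lambda>g. fst (z g)" "\<lambda>g. snd (z g)"])
  have c: "c g \<in> ell scales p" and Y: "?s (c g) \<le> ?K * Y g"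
    and step: "?\<tau> * Y g + ?N (\<lambda>x. g x - synth (c g) x) + ?\<delta> * ?N g \<le> ?N g"
    if "g \<in> Lp_fun lebesgue p" for g
    using P[OF that] unfolding P_def by auto
  define F where "F = rec_nat f (\<lambda>n g x. g x - synth (c g) x)"
  have F0: "F 0 = f" and FS: "\<And>n. F (Suc n) = (\<lambda>x. F n x - synth (c (F n)) x)"
    by (simp_all add: F_def)
  have F: "F n \<in> Lp_fun lebesgue p" for n
    by (induction n) (simp_all add: F0 FS f Lp_fun_diff synth_Lp c)
  define C where "C n = c (F n)" for n
  have C: "C n \<in> ell scales p" for n unfolding C_def by (rule c[OF F])
  have partial: "(\<Sum>n<M. synth (C n) x) = f x - F M x" for M x
    by (induction M) (simp_all add: F0 FS C_def)
  have tele: "(\<Sum>n<M. ?\<tau> * Y (F n) + ?\<delta> * ?N (F n)) + ?N (F M) \<le> ?N f" for M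
  proof (induction M)
    case (Suc M)
    have "(\<Sum>n<Suc M. ?\<tau> * Y (F n) + ?\<delta> * ?N (F n)) + ?N (F (Suc M)) =
        (\<Sum>n<M. ?\<tau> * Y (F n) + ?\<delta> * ?N (F n)) + (?\<tau> * Y (F M) + ?N (F (Suc M)) + ?\<delta> * ?N (F M))"
      by (simp add: ac_simps)
    also have "\<dots> \<le> (\<Sum>n<M. ?\<tau> * Y (F n) + ?\<delta> * ?N (F n)) + ?N (F M)"
      using step[OF F, of M] unfolding FS by (rule add_left_mono)
    also note Suc
    finally show ?case .
  qed (simp add: F0)
  have N: "?N f < \<infinity>" using f by (simp add: Lp_fun_iff)
  have sumY: "?\<tau> * (\<integral>\<^sup>+n. Y (F n) \<partial>count_space UNIV) \<le> ?N f"
  proof -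
    have "?\<tau> * (\<integral>\<^sup>+n. Y (F n) \<partial>count_space UNIV) = (\<integral>\<^sup>+n. ?\<tau> * Y (F n) \<partial>count_space UNIV)"
      by (rule nn_integral_cmult[symmetric]) simp
    also have "\<dots> \<le> ?N f"
    proof (rule nn_integral_count_space_le)
      fix M
      have "(\<Sum>n<M. ?\<tau> * Y (F n)) \<le> (\<Sum>n<M. ?\<tau> * Y (F n) + ?\<delta> * ?N (F n))"
        by (intro sum_mono) simp
      also have "\<dots> \<le> ?N f" by (rule order_trans[OF _ tele[of M]]) simp
      finally show "(\<Sum>n<M. ?\<tau> * Y (F n)) \<le> ?N f" .
    qed
    finally show ?thesis .
  qed
  have sumN: "?\<delta> * (\<integral>\<^sup>+n. ?N (F n) \<partial>count_space UNIV) \<le> ?N f"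
  proof -
    have "?\<delta> * (\<integral>\<^sup>+n. ?N (F n) \<partial>count_space UNIV) = (\<integral>\<^sup>+n. ?\<delta> * ?N (F n) \<partial>count_space UNIV)"
      by (rule nn_integral_cmult[symmetric]) simp
    also have "\<dots> \<le> ?N f"
    proof (rule nn_integral_count_space_le)
      fix M
      have "(\<Sum>n<M. ?\<delta> * ?N (F n)) \<le> (\<Sum>n<M. ?\<tau> * Y (F n) + ?\<delta> * ?N (F n))"
        by (intro sum_mono) simp
      also have "\<dots> \<le> ?N f" by (rule order_trans[OF _ tele[of M]]) simp
      finally show "(\<Sum>n<M. ?\<delta> * ?N (F n)) \<le> ?N f" .
    qed
    finally show ?thesis .
  qed
  have \<tau>\<delta>: "?\<tau> > 0" "?\<delta> > 0" using \<sigma> by simp_all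
  have finY: "(\<integral>\<^sup>+n. Y (F n) \<partial>count_space UNIV) < \<infinity>"
    using le_less_trans[OF sumY N] \<tau>\<delta> by (auto simp: ennreal_mult_less_top)
  have finN: "(\<integral>\<^sup>+n. ?N (F n) \<partial>count_space UNIV) < \<infinity>"
    using le_less_trans[OF sumN N] \<tau>\<delta> by (auto simp: ennreal_mult_less_top)
  have sC: "(\<integral>\<^sup>+n. ?s (C n) \<partial>count_space UNIV) \<le> ?K * (\<integral>\<^sup>+n. Y (F n) \<partial>count_space UNIV)"
  proof -
    have "(\<integral>\<^sup>+n. ?s (C n) \<partial>count_space UNIV) \<le> (\<integral>\<^sup>+n. ?K * Y (F n) \<partial>count_space UNIV)"
      unfolding C_def by (intro nn_integral_mono Y F)
    also have "\<dots> = ?K * (\<integral>\<^sup>+n. Y (F n) \<partial>count_space UNIV)" by (rule nn_integral_cmult) simp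
    finally show ?thesis .
  qed
  also have "\<dots> < \<infinity>" using finY by (simp add: ennreal_mult_less_top)
  finally have fin: "(\<integral>\<^sup>+n. ?s (C n) \<partial>count_space UNIV) < \<infinity>" .
  define c' where "c' i = (\<Sum>\<^sub>\<infinity>n. C n i)" for i
  note sup = synth_superposition[OF C fin, folded c'_def]
  have mF: "(\<lambda>x. pabs p (F n x)) \<in> borel_measurable lebesgue" for n
    using F[of n] by (intro measurable_compose[OF _ measurable_pabs]) (simp add: Lp_fun_iff)
  \<comment> \<open>By Tonelli the summable residual norms make \<bar>F n x\<bar>^p summable in
    \<open>n\<close> at almost every \<open>x\<close>. There \<open>F n x\<close> tends to 0, and
    the partial sums f x - F M x tend to f x.\<close>
  have "AE x in lebesgue. (\<integral>\<^sup>+n. pabs p (F n x) \<partial>count_space UNIV) \<noteq> \<infinity>"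
    using finN by (intro nn_integral_PInf_AE borel_measurable_nn_integral_count_space countableI_type mF)
      (simp add: nn_integral_count_space_nn_integral[OF countableI_type mF])
  then have "AE x in lebesgue. synth c' x = f x"
    using sup(3)
  proof eventually_elim
    case (elim x)
    then have "(\<lambda>n. F n x) \<longlonglongrightarrow> 0" by (intro pabs_summable_tendsto_0) (simp add: less_top)
    then have "(\<lambda>M. f x - F M x) \<longlonglongrightarrow> f x - 0" by (intro tendsto_intros)
    with elim(2) show ?case unfolding partial by (simp add: LIMSEQ_unique)
  qed
  moreover have "?\<tau> * ?s c' \<le> ?K * ?N f"
  proof -
    have "?\<tau> * ?s c' \<le> ?\<tau> * (?K * (\<integral>\<^sup>+n. Y (F n) \<partial>count_space UNIV))"
      using sup(2) sC by (intro mult_left_mono) auto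
    also have "\<dots> = ?K * (?\<tau> * (\<integral>\<^sup>+n. Y (F n) \<partial>count_space UNIV))" by (simp add: ac_simps)
    also have "\<dots> \<le> ?K * ?N f" by (intro mult_left_mono sumY) auto
    finally show ?thesis .
  qed
  ultimately show ?thesis using sup(1) by blast
qed

lemma Lp_dist_eq:
  assumes "f \<in> Lp_fun lebesgue p" "g \<in> Lp_fun lebesgue p"
  shows "ennreal (Lp_dist lebesgue p (Lp_class lebesgue p f) (Lp_class lebesgue p g)) =
    (\<integral>\<^sup>+x. pabs p (f x - g x) \<partial>lebesgue)"
  unfolding Lp_dist_class[OF p(1) assms] by (rule Lp_norm_powr_eq[OF p(1) Lp_fun_diff[OF assms]])

section \<open>Openness and the norm estimate\<close>

lemma open_map_synthesis:
  assumes \<sigma>: "cube_integral (\<lambda>y. pabs p (h lam y)) = ennreal \<sigma>" "0 \<le> \<sigma>" "\<sigma> < \<sigma>'" "\<sigma>' < 1"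
  shows "open_map (Metric_space.mtopology (ell scales p) (ell_dist scales p))
     (Metric_space.mtopology (Lp lebesgue p) (Lp_dist lebesgue p)) (synthesis a b p \<psi>)"
  unfolding open_map_def
proof (intro allI impI)
  interpret E: Metric_space "ell scales p :: (nat \<times> (int ^ 'n) \<Rightarrow> complex) set" "ell_dist scales p"
    by (rule Metric_space_ell[OF p])
  interpret L: Metric_space "Lp lebesgue p :: (real ^ 'n \<Rightarrow> complex) set set" "Lp_dist lebesgue p"
    by (rule Metric_space_Lp[OF p])
  let ?S = "synthesis a b p \<psi>"
  fix U assume "openin E.mtopology U"
  then have U: "U \<subseteq> ell scales p" "\<And>c. c \<in> U \<Longrightarrow> \<exists>r>0. E.mball c r \<subseteq> U"
    by (auto simp: E.openin_mtopology)
  define K where "K = norm lam powr p * D powr (p - 1)"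
  have K: "0 \<le> K" "pabs p lam * ennreal (D powr (p - 1)) = ennreal K"
    by (simp_all add: K_def pabs_def ennreal_mult)
  have "\<exists>r>0. L.mball (?S c) r \<subseteq> ?S ` U" if c: "c \<in> U" for c
  proof -
    obtain r where r: "r > 0" "E.mball c r \<subseteq> U" using U(2)[OF c] by blast
    have cl: "c \<in> ell scales p" using U(1) c by blast
    \<comment> \<open>Solving for a difference of p-th power size below r' costs at most K r'/(1 -
      \<sigma>'), which must stay below \<open>r\<close>. The summand 1 makes this strict and allows
      K = 0, that is lam = 0.\<close>
    define r' where "r' = r * (1 - \<sigma>') / (K + 1)"
    have r': "0 < r'" "K * r' < r * (1 - \<sigma>')"
    proof -
      show "0 < r'" using r(1) \<sigma> K(1) by (simp add: r'_def)
      have "(K + 1) * r' = r * (1 - \<sigma>')" using K(1) by (simp add: r'_def)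
      with \<open>0 < r'\<close> show "K * r' < r * (1 - \<sigma>')" by (simp add: distrib_right)
    qed
    have "L.mball (?S c) r' \<subseteq> ?S ` U"
    proof
      fix H assume "H \<in> L.mball (?S c) r'"
      then have H: "H \<in> Lp lebesgue p" "Lp_dist lebesgue p (?S c) H < r'" by auto
      obtain g where g: "g \<in> Lp_fun lebesgue p" "H = Lp_class lebesgue p g"
        by (rule Lp_cases[OF H(1)])
      let ?g = "\<lambda>x. g x - synth c x"
      have gd: "?g \<in> Lp_fun lebesgue p" by (rule Lp_fun_diff[OF g(1) synth_Lp[OF cl]])
      have "(\<integral>\<^sup>+x. pabs p (?g x) \<partial>lebesgue) = ennreal (Lp_dist lebesgue p (?S c) H)"
        unfolding synthesis_eq g(2) Lp_dist_eq[OF synth_Lp[OF cl] g(1)]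
        by (intro nn_integral_cong pabs_minus_commute)
      also have "\<dots> \<le> ennreal r'" using H(2) by (intro ennreal_leI) simp
      finally have Ng: "(\<integral>\<^sup>+x. pabs p (?g x) \<partial>lebesgue) \<le> ennreal r'" .
      obtain e where e: "e \<in> ell scales p" "AE x in lebesgue. synth e x = ?g x"
        and le: "ennreal (1 - \<sigma>') * (\<integral>\<^sup>+i. pabs p (e i) \<partial>count_space scales) \<le>
          ennreal K * (\<integral>\<^sup>+x. pabs p (?g x) \<partial>lebesgue)"
        using exact_reconstruction[OF gd \<sigma>] unfolding K(2) by blast
      let ?c = "\<lambda>i. c i + e i"
      have c': "?c \<in> ell scales p" by (rule ell_add[OF cl e(1)])
      have "ell_dist scales p c ?c = ell_norm scales p e powr p"
        by (simp add: ell_dist_def ell_norm_def)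
      moreover have "ell_norm scales p e powr p < r"
      proof -
        have "ennreal ((1 - \<sigma>') * ell_norm scales p e powr p) \<le> ennreal K * ennreal r'"
          using le order_trans[OF _ mult_left_mono[OF Ng, of "ennreal K"]] \<sigma>
          by (simp add: ennreal_mult ell_norm_powr[OF p(1) e(1)])
        then have "(1 - \<sigma>') * ell_norm scales p e powr p \<le> K * r'"
          using K(1) r'(1) by (simp flip: ennreal_mult)
        also have "\<dots> < (1 - \<sigma>') * r" using r'(2) by (simp add: mult.commute)
        finally show ?thesis using \<sigma> by simp
      qed
      ultimately have "?c \<in> U" using r(2) cl c' by auto
      moreover have "?S ?c = H"
      proof -
        have "AE x in lebesgue. synth ?c x = g x"
          using AE_synth_add[OF cl e(1)] e(2) by eventually_elim simp
        then show ?thesis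
          unfolding synthesis_eq g(2) by (simp add: Lp_class_eq_iff synth_Lp[OF c'] g(1))
      qed
      ultimately show "H \<in> ?S ` U" by blast
    qed
    with r'(1) show ?thesis by blast
  qed
  moreover have "?S ` U \<subseteq> Lp lebesgue p"
    using U(1) by (auto simp: synthesis_eq intro!: Lp_class_mem synth_Lp)
  ultimately show "openin L.mtopology (?S ` U)"
    by (auto simp: L.openin_mtopology)
qed

text \<open>This takes the p-th root of the preceding estimate; the exponent of \<open>D\<close>
  matches because (1 - 1/p) p = p - 1.\<close>

lemma norm_bound:
  assumes f: "f \<in> Lp_fun lebesgue p" and c: "c \<in> ell scales p" and \<sigma>': "\<sigma>' < 1"
    and le: "ennreal (1 - \<sigma>') * (\<integral>\<^sup>+i. pabs p (c i) \<partial>count_space scales) \<le>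
      pabs p lam * ennreal (D powr (p - 1)) * (\<integral>\<^sup>+x. pabs p (f x) \<partial>lebesgue)"
  shows "ell_norm scales p c \<le>
    (1 - \<sigma>') powr (- 1/p) * norm lam * D powr (1 - 1/p) * Lp_norm lebesgue p f" (is "_ \<le> ?R")
proof -
  let ?e = "ell_norm scales p c powr p" and ?n = "Lp_norm lebesgue p f powr p"
  have nn: "0 \<le> ell_norm scales p c" "0 \<le> Lp_norm lebesgue p f"
    by (simp_all add: ell_norm_def Lp_norm_def)
  have "ennreal ((1 - \<sigma>') * ?e) \<le> ennreal (norm lam powr p * D powr (p - 1) * ?n)"
    using le \<sigma>' unfolding ell_norm_powr[OF p(1) c, symmetric] Lp_norm_powr_eq[OF p(1) f, symmetric]
      pabs_def[of p lam] by (simp add: ennreal_mult)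
  then have "(1 - \<sigma>') * ?e \<le> norm lam powr p * D powr (p - 1) * ?n" by simp
  then have "?e \<le> (1 - \<sigma>') powr (-1) * norm lam powr p * D powr (p - 1) * ?n"
    using \<sigma>' by (simp add: powr_minus divide_simps mult_ac)
  also have "\<dots> = ?R powr p"
  proof -
    have "(1 - 1/p) * p = p - 1" using p by (simp add: left_diff_distrib)
    then show ?thesis using p nn \<sigma>' by (simp add: powr_mult powr_powr)
  qed
  finally have "?e \<le> ?R powr p" .
  moreover have "0 \<le> ?R" using nn by simp
  ultimately show ?thesis
    using p powr_less_mono2[of p ?R "ell_norm scales p c"] by (meson not_le)
qed

end

theorem theorem4:
  fixes a :: "nat \<Rightarrow> real ^ 'n ^ 'n" and b :: "real ^ 'n ^ 'n"
    and p \<sigma> :: real and \<psi> :: "real ^ 'n \<Rightarrow> complex" and lam :: complex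
  assumes "\<And>j. 0 < j \<Longrightarrow> invertible (a j)"
    and "(\<lambda>j. onorm (\<lambda>x. matrix_inv (a j) *v x)) \<longlonglongrightarrow> 0"
    and "invertible b"
    and "0 < p" and "p \<le> 1"
    and "\<psi> \<in> Lp_fun lebesgue p"
    and "\<sigma> = Lp_norm (lebesgue_on unit_cube) p (\<lambda>x. lam * periodization b \<psi> (b *v x) - 1) powr p"
    and "\<sigma> < 1"
  shows "open_map (Metric_space.mtopology (ell scales p) (ell_dist scales p))
           (Metric_space.mtopology (Lp lebesgue p) (Lp_dist lebesgue p))
           (synthesis a b p \<psi>) \<and>
         synthesis a b p \<psi> ` ell scales p = Lp lebesgue p \<and>
         (\<forall>f \<in> Lp_fun lebesgue p. \<forall>\<sigma>' \<in> {\<sigma><..<1}. \<exists>c \<in> ell scales p.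
           synthesis a b p \<psi> c = Lp_class lebesgue p f \<and>
           ell_norm scales p c \<le>
             (1 - \<sigma>') powr (- 1/p) * norm lam * \<bar>det b\<bar> powr (1 - 1/p) * Lp_norm lebesgue p f)"
proof -
  interpret affine_system a b p \<psi> by unfold_locales (fact assms)+
  have \<sigma>0: "0 \<le> \<sigma>" unfolding assms(7) by simp
  have \<sigma>: "cube_integral (\<lambda>y. pabs p (h lam y)) = ennreal \<sigma>"
    unfolding assms(7) h_def[symmetric] by (rule Lp_norm_powr_eq[OF p(1) h_Lp, symmetric])
  have solve: "\<exists>c\<in>ell scales p. synthesis a b p \<psi> c = Lp_class lebesgue p f \<and>
      ell_norm scales p c \<le>
        (1 - \<sigma>') powr (- 1/p) * norm lam * \<bar>det b\<bar> powr (1 - 1/p) * Lp_norm lebesgue p f"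
    if f: "f \<in> Lp_fun lebesgue p" and \<sigma>': "\<sigma> < \<sigma>'" "\<sigma>' < 1" for f \<sigma>'
  proof -
    obtain c where c: "c \<in> ell scales p" "AE x in lebesgue. synth c x = f x"
      and le: "ennreal (1 - \<sigma>') * (\<integral>\<^sup>+i. pabs p (c i) \<partial>count_space scales) \<le>
        pabs p lam * ennreal (D powr (p - 1)) * (\<integral>\<^sup>+x. pabs p (f x) \<partial>lebesgue)"
      using exact_reconstruction[OF f \<sigma> \<sigma>0 \<sigma>'] by blast
    have "synthesis a b p \<psi> c = Lp_class lebesgue p f"
      unfolding synthesis_eq using c by (simp add: Lp_class_eq_iff synth_Lp f)
    with c(1) norm_bound[OF f c(1) \<sigma>'(2) le] show ?thesis by blast
  qed
  \<comment> \<open>Openness and surjectivity do not mention \<sigma>', so any value strictly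
    between \<sigma> and 1 serves for them.\<close>
  obtain \<sigma>' where \<sigma>': "\<sigma> < \<sigma>'" "\<sigma>' < 1" using dense[OF assms(8)] by blast
  have "synthesis a b p \<psi> ` ell scales p = Lp lebesgue p"
  proof
    show "synthesis a b p \<psi> ` ell scales p \<subseteq> Lp lebesgue p"
      by (auto simp: synthesis_eq intro!: Lp_class_mem synth_Lp)
    show "Lp lebesgue p \<subseteq> synthesis a b p \<psi> ` ell scales p"
    proof
      fix F :: "(real ^ 'n \<Rightarrow> complex) set" assume "F \<in> Lp lebesgue p"
      then obtain f where "f \<in> Lp_fun lebesgue p" "F = Lp_class lebesgue p f" by (rule Lp_cases)
      with solve[OF _ \<sigma>', of f] show "F \<in> synthesis a b p \<psi> ` ell scales p" by (metis image_eqI)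
    qed
  qed
  with open_map_synthesis[OF \<sigma> \<sigma>0 \<sigma>'] solve show ?thesis by simp
qed

end
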